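(* For fixed $\ell\in\{1,\dots,L\}$, let $\widetilde w_{jk,\ell g}$ denote the dual frame functions of the frame $\{w_{jk,\ell g}\}_{j,k\in\mathbb{Z},\,g=1,\dots,G}$ over $L_2(\Omega_\ell,\gamma_\ell)$. Then, for all $j,k\in\mathbb{Z}$ and $g=1,\dots,G$, there holds $$\widetilde w_{jk,\ell g}(x,y)=\frac{w_{jk,\ell g}(x,y)}{O_\ell(x,y)},\qquad\forall\,(x,y)\in\Omega_\ell.$$
   Context: Let $\Omega_A\subset\mathbb{R}^2$ be a domain (telescope aperture), $L,G\in\mathbb{N}$, $0\le h_1<\dots<h_L$ (layer heights), $\alpha_g=(\alpha_g^x,\alpha_g^y)\in\mathbb{R}^2$ for $g=1,\dots,G$ (guide star directions), and $\gamma_\ell>0$ with $\sum_{\ell=1}^L\gamma_\ell=1$ (turbulence weights). Let $G=G_{\mathrm{NGS}}+G_{\mathrm{LGS}}$, let $h_{\mathrm{LGS}}>h_\ell$ for all $\ell$, and put $c_{\ell,g}=1$ for $g\le G_{\mathrm{NGS}}$ and $c_{\ell,g}=1-h_\ell/h_{\mathrm{LGS}}$ for $g>G_{\mathrm{NGS}}$, so $c_{\ell,g}\in(0,1]$; put $c_\ell:=\min_gc_{\ell,g}$. Define $$\Omega_A(\alpha_gh_\ell):=\Big\{r\in\mathbb{R}^2\ \Big|\ \frac{r-\alpha_gh_\ell}{c_{\ell,g}}\in\Omega_A\Big\},\qquad \Omega_\ell:=\bigcup_{g=1}^G\Omega_A(\alpha_gh_\ell).$$ Let $\Omega_T=[-T,T]^2$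 with $T>0$ sufficiently large that for all $g,\ell$: $\Omega_A+\alpha_gh_\ell\subset c_\ell\Omega_T$, $\Omega_A\subset\Omega_T$, and $\Omega_A(\alpha_gh_\ell)\subset c_{\ell,g}\Omega_T$. $L_2(\Omega_\ell,\gamma_\ell)$ is the (complex) space $L_2(\Omega_\ell)$ with inner product $\langle u,v\rangle_{L_2(\Omega_\ell,\gamma_\ell)}=\frac1{\gamma_\ell}\int_{\Omega_\ell}u\overline v\,\mathrm{d}r$. Pointwise identities between $L_2$ functions are understood almost everywhere. Let $I_{\ell g}$ be the indicator function of $\Omega_A(\alpha_gh_\ell)$ and $O_\ell(x,y):=\sum_{g=1}^GI_{\ell g}(x,y)$ the overlay function. For $j,k\in\mathbb{Z}$ put $$w_{jk}(x,y):=\frac1{2T}e^{i\omega(jx+ky)},\ \ \omega=\frac\pi T,\qquad w_{jk,\ell g}(x,y):=\frac{\sqrt{\gamma_\ell}}{c_{\ell,g}}\,w_{jk}\big((x,y)/c_{\ell,g}\big)\,I_{\ell g}(x,y).$$ For a frame $\{e_k\}_{k\in K}$ over a Hilbert space $H$ (i.e. there are $0<A\le B<\infty$ with $A\|f\|^2\le\sum_k|\langle f,e_k\rangle|^2\le B\|f\|^2$ for all $f\in H$), the operator $Sf:=\sum_{k\in K}\langle f,e_k\rangle e_k$ is continuously invertible on $H$, and the dual frame is $\{\widetilde e_k\}_{k\in K}$ with $\widetilde e_k:=S^{-1}e_k$. It is known that $\{w_{jk,\ell g}\}_{j,k\in\mathbb{Z},\,g=1,\dots,G}$ is a frame over $L_2(\Omega_\ell,\gamma_\ell)$.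 *)

theory Defs
  imports "HOL-Analysis.Analysis"
begin

section \<open>The weighted space of square-integrable functions, frames and dual frames\<close>

text \<open>
  Elements of the space are represented by functions; equality in the space is equality almost
  everywhere with respect to \<open>M\<close>. The weight \<open>\<gamma>\<close> only enters the inner product.
\<close>

definition L2_space :: "'a measure \<Rightarrow> ('a \<Rightarrow> complex) set" where
  "L2_space M = {f \<in> borel_measurable M. integrable M (\<lambda>x. (cmod (f x))\<^sup>2)}"

definition L2_inner :: "'a measure \<Rightarrow> real \<Rightarrow> ('a \<Rightarrow> complex) \<Rightarrow> ('a \<Rightarrow> complex) \<Rightarrow> complex" where
  "L2_inner M \<gamma> u v = complex_of_real (1 / \<gamma>) * (LINT x|M. u x * cnj (v x))"

definition L2_norm :: "'a measure \<Rightarrow> real \<Rightarrow> ('a \<Rightarrow> complex) \<Rightarrow> real" where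
  "L2_norm M \<gamma> f = sqrt (Re (L2_inner M \<gamma> f f))"

definition L2_frame :: "'a measure \<Rightarrow> real \<Rightarrow> 'k set \<Rightarrow> ('k \<Rightarrow> 'a \<Rightarrow> complex) \<Rightarrow> bool" where
  "L2_frame M \<gamma> K e \<longleftrightarrow>
     (\<forall>k\<in>K. e k \<in> L2_space M) \<and>
     (\<exists>A B. 0 < A \<and> A \<le> B \<and>
       (\<forall>f\<in>L2_space M.
          (\<lambda>k. (cmod (L2_inner M \<gamma> f (e k)))\<^sup>2) summable_on K \<and>
          A * (L2_norm M \<gamma> f)\<^sup>2 \<le> (\<Sum>\<^sub>\<infinity>k\<in>K. (cmod (L2_inner M \<gamma> f (e k)))\<^sup>2) \<and>
          (\<Sum>\<^sub>\<infinity>k\<in>K. (cmod (L2_inner M \<gamma> f (e k)))\<^sup>2) \<le> B * (L2_norm M \<gamma> f)\<^sup>2))"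

text \<open>
  The series defining the frame operator converges unconditionally in the norm of the space,
  i.e. along the net of finite subsets of the index set. Its sum, and likewise the preimage under
  the frame operator, is determined only up to null sets; \<open>SOME\<close> picks a representative.
\<close>

definition frame_operator ::
  "'a measure \<Rightarrow> real \<Rightarrow> 'k set \<Rightarrow> ('k \<Rightarrow> 'a \<Rightarrow> complex) \<Rightarrow> ('a \<Rightarrow> complex) \<Rightarrow> 'a \<Rightarrow> complex" where
  "frame_operator M \<gamma> K e f =
     (SOME s. s \<in> L2_space M \<and>
        ((\<lambda>F. L2_norm M \<gamma> (\<lambda>x. (\<Sum>k\<in>F. L2_inner M \<gamma> f (e k) * e k x) - s x)) \<longlongrightarrow> 0)
          (finite_subsets_at_top K))"

definition inv_frame_operator ::
  "'a measure \<Rightarrow> real \<Rightarrow> 'k set \<Rightarrow> ('k \<Rightarrow> 'a \<Rightarrow> complex) \<Rightarrow> ('a \<Rightarrow> complex) \<Rightarrow> 'a \<Rightarrow> complex" where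
  "inv_frame_operator M \<gamma> K e s =
     (SOME f. f \<in> L2_space M \<and> (AE x in M. frame_operator M \<gamma> K e f x = s x))"

text \<open>The dual frame is left unspecified unless the family is a frame.\<close>

definition dual_frame ::
  "'a measure \<Rightarrow> real \<Rightarrow> 'k set \<Rightarrow> ('k \<Rightarrow> 'a \<Rightarrow> complex) \<Rightarrow> 'k \<Rightarrow> 'a \<Rightarrow> complex" where
  "dual_frame M \<gamma> K e =
     (if L2_frame M \<gamma> K e then (\<lambda>k. inv_frame_operator M \<gamma> K e (e k)) else undefined)"

section \<open>The atmospheric tomography setting\<close>

text \<open>
  Layers \<open>l\<close> range over \<open>{1..L}\<close> and guide stars \<open>g\<close> over \<open>{1..G}\<close>; the first \<open>G_NGS\<close> of the
  latter are natural, the others are laser guide stars. Below, \<open>c l g\<close> stands for the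
  resulting cone compression factor.
\<close>

definition cone_factor :: "nat \<Rightarrow> real \<Rightarrow> (nat \<Rightarrow> real) \<Rightarrow> nat \<Rightarrow> nat \<Rightarrow> real" where
  "cone_factor G_NGS h_LGS h l g = (if g \<le> G_NGS then 1 else 1 - h l / h_LGS)"

definition min_cone_factor :: "(nat \<Rightarrow> nat \<Rightarrow> real) \<Rightarrow> nat \<Rightarrow> nat \<Rightarrow> real" where
  "min_cone_factor c G l = Min ((\<lambda>g. c l g) ` {1..G})"

definition square_domain :: "real \<Rightarrow> (real \<times> real) set" where
  "square_domain T = {-T..T} \<times> {-T..T}"

definition layer_aperture ::
  "(real \<times> real) set \<Rightarrow> (nat \<Rightarrow> real \<times> real) \<Rightarrow> (nat \<Rightarrow> real) \<Rightarrow> (nat \<Rightarrow> nat \<Rightarrow> real) \<Rightarrow>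
   nat \<Rightarrow> nat \<Rightarrow> (real \<times> real) set" where
  "layer_aperture \<Omega>\<^sub>A \<alpha> h c l g = {r. (r - h l *\<^sub>R \<alpha> g) /\<^sub>R c l g \<in> \<Omega>\<^sub>A}"

definition layer_domain ::
  "(real \<times> real) set \<Rightarrow> (nat \<Rightarrow> real \<times> real) \<Rightarrow> (nat \<Rightarrow> real) \<Rightarrow> (nat \<Rightarrow> nat \<Rightarrow> real) \<Rightarrow>
   nat \<Rightarrow> nat \<Rightarrow> (real \<times> real) set" where
  "layer_domain \<Omega>\<^sub>A \<alpha> h c G l = (\<Union>g\<in>{1..G}. layer_aperture \<Omega>\<^sub>A \<alpha> h c l g)"

definition overlay ::
  "(real \<times> real) set \<Rightarrow> (nat \<Rightarrow> real \<times> real) \<Rightarrow> (nat \<Rightarrow> real) \<Rightarrow> (nat \<Rightarrow> nat \<Rightarrow> real) \<Rightarrow>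
   nat \<Rightarrow> nat \<Rightarrow> real \<times> real \<Rightarrow> real" where
  "overlay \<Omega>\<^sub>A \<alpha> h c G l r = (\<Sum>g=1..G. indicator (layer_aperture \<Omega>\<^sub>A \<alpha> h c l g) r)"

definition fourier_fun :: "real \<Rightarrow> int \<Rightarrow> int \<Rightarrow> real \<times> real \<Rightarrow> complex" where
  "fourier_fun T j k = (\<lambda>(x, y).
     complex_of_real (1 / (2 * T)) *
     exp (\<i> * complex_of_real (pi / T * (of_int j * x + of_int k * y))))"

definition layer_frame_fun ::
  "(real \<times> real) set \<Rightarrow> (nat \<Rightarrow> real \<times> real) \<Rightarrow> (nat \<Rightarrow> real) \<Rightarrow> (nat \<Rightarrow> nat \<Rightarrow> real) \<Rightarrow>
   (nat \<Rightarrow> real) \<Rightarrow> real \<Rightarrow> nat \<Rightarrow> int \<times> int \<times> nat \<Rightarrow> real \<times> real \<Rightarrow> complex" where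
  "layer_frame_fun \<Omega>\<^sub>A \<alpha> h c \<gamma> T l = (\<lambda>(j, k, g) r.
     complex_of_real (sqrt (\<gamma> l) / c l g) * fourier_fun T j k (r /\<^sub>R c l g) *
     indicator (layer_aperture \<Omega>\<^sub>A \<alpha> h c l g) r)"

end

theory Submission
  imports Defs
begin

text \<open>
  Why the dual frame is obtained by dividing by the overlay function. Fix the layer. For a single guide
  star \<open>g\<close>, the frame functions are \<open>sqrt \<gamma>\<close> times the exponentials that form the Fourier orthonormal
  basis of the square \<open>c\<^sub>g \<Omega>\<^sub>T\<close>, cut off to the aperture \<open>A\<^sub>g\<close>, which lies inside that square. The
  coefficients of \<open>f\<close> are, up to normalisation, the Fourier coefficients of \<open>1\<^bsub>A g\<^esub> f\<close>, so
  Parseval's identity gives their total mass as \<open>\<parallel>1\<^bsub>A g\<^esub> f\<parallel>\<^sup>2\<close>, and the Fourier series of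
  \<open>1\<^bsub>A g\<^esub> f\<close>, cut off once more, reproduces \<open>1\<^bsub>A g\<^esub> f\<close>
  (\<open>local_tight_family_restricted_basis\<close>).

  Summation over \<open>g\<close> shows that the frame operator is multiplication by the overlay function
  \<open>O = \<Sum>\<^sub>g 1\<^bsub>A g\<^esub>\<close>. On the layer domain \<open>1 \<le> O \<le> G\<close>, so the family is a frame and the inverse of
  the frame operator is division by \<open>O\<close> (\<open>overlay_dual_frame\<close>).

  The analytic input is the completeness of the double Fourier system on a square
  (\<open>fourier_orthonormal_basis\<close>). It follows from the Stone--Weierstrass theorem on the torus, embedded
  in \<open>\<complex> \<times> \<complex>\<close> as a product of two unit circles (\<open>trig_poly_uniform_approximation\<close>), and from the
  fact that the continuous functions vanishing on the boundary of the square are dense in the space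
  (\<open>L2_truncation\<close>, \<open>continuous_vanishing_approximation\<close>).
\<close>

section \<open>Square-integrable functions\<close>

lemma L2_space_measurable: "f \<in> L2_space M \<Longrightarrow> f \<in> borel_measurable M"
  and L2_space_integrable: "f \<in> L2_space M \<Longrightarrow> integrable M (\<lambda>x. (cmod (f x))\<^sup>2)"
  by (auto simp: L2_space_def)

lemma L2_space_dominated:
  assumes "f \<in> borel_measurable M" and "integrable M g"
    and "\<And>x. x \<in> space M \<Longrightarrow> (cmod (f x))\<^sup>2 \<le> g x"
  shows "f \<in> L2_space M"
proof -
  have "integrable M (\<lambda>x. (cmod (f x))\<^sup>2)"
    by (rule Bochner_Integration.integrable_bound[OF assms(2)])
       (use assms in \<open>auto intro!: AE_I2 order_trans[OF assms(3)]\<close>)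
  then show ?thesis using assms(1) by (simp add: L2_space_def)
qed

lemma L2_space_mult_bounded:
  assumes f: "f \<in> L2_space M" and w: "w \<in> borel_measurable M"
    and B: "\<And>x. x \<in> space M \<Longrightarrow> cmod (w x) \<le> B"
  shows "(\<lambda>x. w x * f x) \<in> L2_space M"
proof (rule L2_space_dominated)
  show "(\<lambda>x. w x * f x) \<in> borel_measurable M"
    using L2_space_measurable[OF f] w by measurable
  show "integrable M (\<lambda>x. B\<^sup>2 * (cmod (f x))\<^sup>2)"
    using L2_space_integrable[OF f] by simp
  show "(cmod (w x * f x))\<^sup>2 \<le> B\<^sup>2 * (cmod (f x))\<^sup>2" if "x \<in> space M" for x
    using B[OF that] by (auto simp: norm_mult power_mult_distrib intro!: mult_right_mono power_mono)
qed

lemma L2_space_cmult: "f \<in> L2_space M \<Longrightarrow> (\<lambda>x. a * f x) \<in> L2_space M"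
  by (rule L2_space_mult_bounded[where B = "cmod a"]) auto

lemma L2_space_indicator_mult:
  "f \<in> L2_space M \<Longrightarrow> A \<in> sets M \<Longrightarrow> (\<lambda>x. indicator A x * f x) \<in> L2_space M"
  by (rule L2_space_mult_bounded[where B = 1]) (auto simp: indicator_def)

lemma L2_space_add:
  assumes "f \<in> L2_space M" "g \<in> L2_space M"
  shows "(\<lambda>x. f x + g x) \<in> L2_space M"
proof (rule L2_space_dominated)
  show "(\<lambda>x. f x + g x) \<in> borel_measurable M"
    using assms[THEN L2_space_measurable] by measurable
  show "integrable M (\<lambda>x. 2 * (cmod (f x))\<^sup>2 + 2 * (cmod (g x))\<^sup>2)"
    using assms[THEN L2_space_integrable] by simp
  show "(cmod (f x + g x))\<^sup>2 \<le> 2 * (cmod (f x))\<^sup>2 + 2 * (cmod (g x))\<^sup>2" for x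
  proof -
    have "(cmod (f x + g x))\<^sup>2 \<le> (cmod (f x) + cmod (g x))\<^sup>2"
      by (intro power_mono norm_triangle_ineq) auto
    also have "\<dots> \<le> 2 * (cmod (f x))\<^sup>2 + 2 * (cmod (g x))\<^sup>2"
      using sum_squares_bound[of "cmod (f x)" "cmod (g x)"] by (simp add: power2_sum)
    finally show ?thesis .
  qed
qed

lemma L2_space_diff:
  "f \<in> L2_space M \<Longrightarrow> g \<in> L2_space M \<Longrightarrow> (\<lambda>x. f x - g x) \<in> L2_space M"
  using L2_space_add[of f M "\<lambda>x. - 1 * g x"] L2_space_cmult[of g M "-1"] by simp

lemma L2_space_sum:
  "(\<And>k. k \<in> F \<Longrightarrow> f k \<in> L2_space M) \<Longrightarrow> (\<lambda>x. \<Sum>k\<in>F. f k x) \<in> L2_space M"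
proof (induction F rule: infinite_finite_induct)
  case (insert k F)
  then show ?case using L2_space_add[of "f k" M "\<lambda>x. \<Sum>k\<in>F. f k x"] by simp
qed (auto simp: L2_space_def)

lemma L2_integrable_mult_cnj:
  assumes "f \<in> L2_space M" "g \<in> L2_space M"
  shows "integrable M (\<lambda>x. f x * cnj (g x))"
proof (rule Bochner_Integration.integrable_bound)
  show "integrable M (\<lambda>x. (cmod (f x))\<^sup>2 + (cmod (g x))\<^sup>2)"
    using assms[THEN L2_space_integrable] by simp
  have "(\<lambda>x. cnj (g x)) \<in> borel_measurable M"
    using L2_space_measurable[OF assms(2)]
    by (rule borel_measurable_continuous_on[rotated]) (intro continuous_intros)
  then show "(\<lambda>x. f x * cnj (g x)) \<in> borel_measurable M"
    using L2_space_measurable[OF assms(1)] by measurable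
  show "AE x in M. norm (f x * cnj (g x)) \<le> norm ((cmod (f x))\<^sup>2 + (cmod (g x))\<^sup>2)"
  proof (rule AE_I2)
    fix x
    have "2 * (cmod (f x) * cmod (g x)) \<le> (cmod (f x))\<^sup>2 + (cmod (g x))\<^sup>2"
      using sum_squares_bound[of "cmod (f x)" "cmod (g x)"] by simp
    moreover have "0 \<le> cmod (f x) * cmod (g x)" by simp
    ultimately have "cmod (f x) * cmod (g x) \<le> (cmod (f x))\<^sup>2 + (cmod (g x))\<^sup>2" by linarith
    then show "norm (f x * cnj (g x)) \<le> norm ((cmod (f x))\<^sup>2 + (cmod (g x))\<^sup>2)"
      by (simp add: norm_mult)
  qed
qed

lemma L2_inner_self: "L2_inner M \<gamma> f f = of_real (1 / \<gamma> * (LINT x|M. (cmod (f x))\<^sup>2))"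
proof -
  have "(\<lambda>x. f x * cnj (f x)) = (\<lambda>x. complex_of_real ((cmod (f x))\<^sup>2))"
    by (rule ext) (rule complex_norm_square[symmetric])
  then show ?thesis by (simp only: L2_inner_def of_real_mult integral_complex_of_real)
qed

lemma L2_norm_squared:
  "\<gamma> > 0 \<Longrightarrow> (L2_norm M \<gamma> f)\<^sup>2 = 1 / \<gamma> * (LINT x|M. (cmod (f x))\<^sup>2)"
  by (simp add: L2_norm_def L2_inner_self)

lemma L2_norm_nonneg: "\<gamma> > 0 \<Longrightarrow> 0 \<le> L2_norm M \<gamma> f"
  by (simp add: L2_norm_def L2_inner_self)

text \<open>
  Cauchy--Schwarz over the finite index set replaces the triangle inequality: the squared norms are
  what the coefficient sums control, so no square roots have to be estimated.
\<close>

lemma L2_norm_sum_squared_le: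
  assumes "\<gamma> > 0" "finite J" "\<And>g. g \<in> J \<Longrightarrow> u g \<in> L2_space M"
  shows "(L2_norm M \<gamma> (\<lambda>x. \<Sum>g\<in>J. u g x))\<^sup>2 \<le> card J * (\<Sum>g\<in>J. (L2_norm M \<gamma> (u g))\<^sup>2)"
proof -
  have "(LINT x|M. (cmod (\<Sum>g\<in>J. u g x))\<^sup>2) \<le> (LINT x|M. card J * (\<Sum>g\<in>J. (cmod (u g x))\<^sup>2))"
  proof (rule integral_mono)
    show "integrable M (\<lambda>x. (cmod (\<Sum>g\<in>J. u g x))\<^sup>2)"
      using assms by (intro L2_space_integrable L2_space_sum)
    show "integrable M (\<lambda>x. card J * (\<Sum>g\<in>J. (cmod (u g x))\<^sup>2))"
      using assms by (intro integrable_mult_right Bochner_Integration.integrable_sum L2_space_integrable)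
    fix x
    have "(cmod (\<Sum>g\<in>J. u g x))\<^sup>2 \<le> (\<Sum>g\<in>J. 1 * cmod (u g x))\<^sup>2"
      by (intro power_mono) (auto intro: norm_sum)
    also have "\<dots> \<le> (\<Sum>g\<in>J. 1\<^sup>2) * (\<Sum>g\<in>J. (cmod (u g x))\<^sup>2)"
      by (rule Cauchy_Schwarz_ineq_sum)
    finally show "(cmod (\<Sum>g\<in>J. u g x))\<^sup>2 \<le> card J * (\<Sum>g\<in>J. (cmod (u g x))\<^sup>2)" by simp
  qed
  also have "\<dots> = card J * (\<Sum>g\<in>J. LINT x|M. (cmod (u g x))\<^sup>2)"
    using assms by (simp add: L2_space_integrable)
  finally have "1 / \<gamma> * (LINT x|M. (cmod (\<Sum>g\<in>J. u g x))\<^sup>2) \<le>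
      1 / \<gamma> * (card J * (\<Sum>g\<in>J. LINT x|M. (cmod (u g x))\<^sup>2))"
    using assms(1) by (intro mult_left_mono) auto
  then show ?thesis
    using assms(1) by (simp add: L2_norm_squared sum_distrib_left sum_divide_distrib algebra_simps)
qed

lemma L2_norm_eq_0_AE:
  assumes "\<gamma> > 0" "u \<in> L2_space M" "L2_norm M \<gamma> u = 0"
  shows "AE x in M. u x = 0"
proof -
  have "(LINT x|M. (cmod (u x))\<^sup>2) = 0"
    using assms L2_norm_squared[of \<gamma> M u] by simp
  then have "AE x in M. (cmod (u x))\<^sup>2 = 0"
    using integral_nonneg_eq_0_iff_AE[OF L2_space_integrable[OF assms(2)]] by simp
  then show ?thesis by simp
qed

text \<open>
  The case of two summands, indexed by the Booleans.
\<close>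

lemma L2_norm_diff_squared_le:
  assumes "\<gamma> > 0" "u \<in> L2_space M" "v \<in> L2_space M"
  shows "(L2_norm M \<gamma> (\<lambda>x. u x - v x))\<^sup>2 \<le> 2 * ((L2_norm M \<gamma> u)\<^sup>2 + (L2_norm M \<gamma> v)\<^sup>2)"
proof -
  let ?w = "\<lambda>b. if b then u else (\<lambda>x. - 1 * v x)"
  have "(L2_norm M \<gamma> (\<lambda>x. \<Sum>b\<in>UNIV. ?w b x))\<^sup>2 \<le>
      card (UNIV :: bool set) * (\<Sum>b\<in>UNIV. (L2_norm M \<gamma> (?w b))\<^sup>2)"
    using assms L2_space_cmult[OF assms(3), of "-1"] by (intro L2_norm_sum_squared_le) auto
  moreover have "(\<lambda>x. \<Sum>b\<in>UNIV. ?w b x) = (\<lambda>x. u x - v x)"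
    by (auto simp: UNIV_bool)
  moreover have "(\<Sum>b\<in>UNIV. (L2_norm M \<gamma> (?w b))\<^sup>2) = (L2_norm M \<gamma> u)\<^sup>2 + (L2_norm M \<gamma> v)\<^sup>2"
    using assms(1) by (simp add: UNIV_bool L2_norm_squared)
  ultimately show ?thesis by simp
qed

text \<open>
  Limits in the norm are unique up to null sets. This is what makes the choice of a
  representative in the frame operator harmless.
\<close>

lemma L2_norm_limit_unique:
  assumes \<gamma>: "\<gamma> > 0" and P: "P \<noteq> bot" and p: "\<And>F. p F \<in> L2_space M"
    and s: "s \<in> L2_space M" and t: "t \<in> L2_space M"
    and ps: "((\<lambda>F. L2_norm M \<gamma> (\<lambda>x. p F x - s x)) \<longlongrightarrow> 0) P"
    and pt: "((\<lambda>F. L2_norm M \<gamma> (\<lambda>x. p F x - t x)) \<longlongrightarrow> 0) P"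
  shows "AE x in M. s x = t x"
proof -
  have le: "(L2_norm M \<gamma> (\<lambda>x. s x - t x))\<^sup>2 \<le>
      2 * ((L2_norm M \<gamma> (\<lambda>x. p F x - t x))\<^sup>2 + (L2_norm M \<gamma> (\<lambda>x. p F x - s x))\<^sup>2)" for F
    using L2_norm_diff_squared_le[OF \<gamma> L2_space_diff[OF p t] L2_space_diff[OF p s], of F F]
    by simp
  have "((\<lambda>F. 2 * ((L2_norm M \<gamma> (\<lambda>x. p F x - t x))\<^sup>2 + (L2_norm M \<gamma> (\<lambda>x. p F x - s x))\<^sup>2))
      \<longlongrightarrow> 2 * (0\<^sup>2 + 0\<^sup>2)) P"
    by (intro tendsto_intros ps pt)
  then have "(L2_norm M \<gamma> (\<lambda>x. s x - t x))\<^sup>2 \<le> 2 * (0\<^sup>2 + 0\<^sup>2)"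
    by (rule tendsto_lowerbound) (use le P in auto)
  then have "L2_norm M \<gamma> (\<lambda>x. s x - t x) = 0" by simp
  then have "AE x in M. s x - t x = 0"
    by (rule L2_norm_eq_0_AE[OF \<gamma> L2_space_diff[OF s t]])
  then show ?thesis by simp
qed

text \<open>
  A quasi-triangle inequality for squared distances; the factor 2 is absorbed by the choice of the
  accuracies in the density argument.
\<close>

lemma LINT_square_diff_le:
  assumes "u \<in> L2_space M" "v \<in> L2_space M" "w \<in> L2_space M"
  shows "(LINT x|M. (cmod (u x - w x))\<^sup>2) \<le>
    2 * ((LINT x|M. (cmod (u x - v x))\<^sup>2) + (LINT x|M. (cmod (v x - w x))\<^sup>2))"
proof -
  have "cmod (v x - w x) = cmod (w x - v x)" for x by (rule norm_minus_commute)
  then show ?thesis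
    using L2_norm_diff_squared_le[of 1 "\<lambda>x. u x - v x" M "\<lambda>x. w x - v x"] assms
    by (simp add: L2_norm_squared L2_space_diff)
qed

section \<open>Orthonormal bases and Parseval's identity\<close>

definition orthonormal_family :: "'a measure \<Rightarrow> ('k \<Rightarrow> 'a \<Rightarrow> complex) \<Rightarrow> bool" where
  "orthonormal_family M e \<longleftrightarrow>
     (\<forall>k. e k \<in> L2_space M) \<and> (\<forall>j k. L2_inner M 1 (e j) (e k) = of_bool (j = k))"

text \<open>
  Completeness is expressed by density of the finite linear combinations, the form in which
  approximation theorems deliver it.
\<close>

definition orthonormal_basis :: "'a measure \<Rightarrow> ('k \<Rightarrow> 'a \<Rightarrow> complex) \<Rightarrow> bool" where
  "orthonormal_basis M e \<longleftrightarrow> orthonormal_family M e \<and>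
     (\<forall>f\<in>L2_space M. \<forall>\<epsilon>>0. \<exists>F d. finite F \<and>
        (LINT x|M. (cmod (f x - (\<Sum>k\<in>F. d k * e k x)))\<^sup>2) < \<epsilon>)"

text \<open>
  The Pythagorean identity behind Bessel's inequality, best approximation and Parseval's identity:
  among all coefficients \<open>d\<close>, the inner products minimise the error, and the minimal error is the
  part of the norm that the coefficients in \<open>F\<close> miss. By induction on \<open>F\<close>, as each new \<open>e k\<close> is
  orthogonal to the approximants built so far.
\<close>

lemma orthonormal_approximation_error:
  assumes e: "orthonormal_family M e" and f: "f \<in> L2_space M" and F: "finite F"
  shows "(LINT x|M. (cmod (f x - (\<Sum>k\<in>F. d k * e k x)))\<^sup>2) =
    (LINT x|M. (cmod (f x))\<^sup>2) - (\<Sum>k\<in>F. (cmod (L2_inner M 1 f (e k)))\<^sup>2)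
      + (\<Sum>k\<in>F. (cmod (d k - L2_inner M 1 f (e k)))\<^sup>2)"
  using F
proof (induction F)
  case empty
  then show ?case by simp
next
  case (insert k F)
  have eL: "\<And>k. e k \<in> L2_space M"
    and orth: "\<And>j k. (LINT x|M. e j x * cnj (e k x)) = of_bool (j = k)"
    using e by (auto simp: orthonormal_family_def L2_inner_def)
  define r where "r x = f x - (\<Sum>k\<in>F. d k * e k x)" for x
  define c where "c = L2_inner M 1 f (e k)"
  have r: "r \<in> L2_space M"
    unfolding r_def by (intro L2_space_diff f L2_space_sum L2_space_cmult eL)
  have re: "(LINT x|M. r x * cnj (e k x)) = c"
  proof -
    have "(\<lambda>x. r x * cnj (e k x)) =
        (\<lambda>x. f x * cnj (e k x) - (\<Sum>j\<in>F. d j * (e j x * cnj (e k x))))"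
      by (auto simp: r_def fun_eq_iff algebra_simps sum_distrib_left sum_distrib_right)
    then have "(LINT x|M. r x * cnj (e k x)) =
        (LINT x|M. f x * cnj (e k x)) - (\<Sum>j\<in>F. d j * (LINT x|M. e j x * cnj (e k x)))"
      by (simp add: L2_integrable_mult_cnj f eL)
    also have "(\<Sum>j\<in>F. d j * (LINT x|M. e j x * cnj (e k x))) = 0"
      using insert.hyps by (intro sum.neutral) (auto simp: orth)
    finally show ?thesis by (simp add: c_def L2_inner_def)
  qed
  have ee: "(LINT x|M. (cmod (e k x))\<^sup>2) = 1"
    using L2_inner_self[of M 1 "e k"] orth[of k k] by (simp add: L2_inner_def)
  have eq: "(cmod (r x - d k * e k x))\<^sup>2 =
      (cmod (r x))\<^sup>2 - 2 * Re (cnj (d k) * (r x * cnj (e k x))) + (cmod (d k))\<^sup>2 * (cmod (e k x))\<^sup>2" for x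
    unfolding cmod_power2 by (simp add: power2_eq_square algebra_simps)
  have "(LINT x|M. (cmod (r x - d k * e k x))\<^sup>2) =
      (LINT x|M. (cmod (r x))\<^sup>2) - 2 * Re (cnj (d k) * c) + (cmod (d k))\<^sup>2"
    unfolding eq
    by (simp add: L2_integrable_mult_cnj r eL L2_space_integrable ee re integral_Re
             del: Re_complex_of_real times_complex.sel(1))
  also have "\<dots> = (LINT x|M. (cmod (r x))\<^sup>2) - (cmod c)\<^sup>2 + (cmod (d k - c))\<^sup>2"
    unfolding cmod_power2 by (simp add: power2_eq_square algebra_simps)
  finally have *: "(LINT x|M. (cmod (r x - d k * e k x))\<^sup>2) =
      (LINT x|M. (cmod (r x))\<^sup>2) - (cmod c)\<^sup>2 + (cmod (d k - c))\<^sup>2" .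
  have step: "f x - (\<Sum>k\<in>insert k F. d k * e k x) = r x - d k * e k x" for x
    using insert.hyps by (simp add: r_def)
  show ?case
    unfolding step * using insert by (simp add: r_def c_def)
qed

text \<open>
  Bessel's inequality bounds every finite coefficient sum by the squared norm; conversely an
  approximant with error below \<open>\<epsilon>\<close> forces the coefficients on its index set to carry all but \<open>\<epsilon>\<close> of
  the squared norm.
\<close>

lemma orthonormal_basis_Parseval:
  assumes e: "orthonormal_basis M e" and f: "f \<in> L2_space M"
  shows "((\<lambda>k. (cmod (L2_inner M 1 f (e k)))\<^sup>2) has_sum (LINT x|M. (cmod (f x))\<^sup>2)) UNIV"
proof -
  let ?c = "\<lambda>k. L2_inner M 1 f (e k)" and ?N = "LINT x|M. (cmod (f x))\<^sup>2"
  have on: "orthonormal_family M e" using e by (simp add: orthonormal_basis_def)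
  have Bessel: "(\<Sum>k\<in>F. (cmod (?c k))\<^sup>2) \<le> ?N" if "finite F" for F
  proof -
    have "0 \<le> (LINT x|M. (cmod (f x - (\<Sum>k\<in>F. ?c k * e k x)))\<^sup>2)" by simp
    then show ?thesis
      using orthonormal_approximation_error[OF on f that, of ?c] by simp
  qed
  show ?thesis unfolding has_sum_def
  proof (rule tendstoI)
    fix \<epsilon> :: real assume "\<epsilon> > 0"
    then obtain F d where F: "finite F" "(LINT x|M. (cmod (f x - (\<Sum>k\<in>F. d k * e k x)))\<^sup>2) < \<epsilon>"
      using e f unfolding orthonormal_basis_def by blast
    have "(\<Sum>k\<in>F. (cmod (d k - ?c k))\<^sup>2) \<ge> 0" by (simp add: sum_nonneg)
    then have large: "?N - \<epsilon> < (\<Sum>k\<in>F. (cmod (?c k))\<^sup>2)"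
      using F orthonormal_approximation_error[OF on f F(1), of d] by linarith
    show "\<forall>\<^sub>F F in finite_subsets_at_top UNIV. dist (\<Sum>k\<in>F. (cmod (?c k))\<^sup>2) ?N < \<epsilon>"
      unfolding eventually_finite_subsets_at_top
    proof (intro exI[of _ F] conjI allI impI)
      fix Y assume Y: "finite Y \<and> F \<subseteq> Y \<and> Y \<subseteq> UNIV"
      then have "(\<Sum>k\<in>F. (cmod (?c k))\<^sup>2) \<le> (\<Sum>k\<in>Y. (cmod (?c k))\<^sup>2)"
        by (intro sum_mono2) auto
      then show "dist (\<Sum>k\<in>Y. (cmod (?c k))\<^sup>2) ?N < \<epsilon>"
        using Bessel[of Y] Y large by (auto simp: dist_real_def)
    qed (use F in auto)
  qed
qed

section \<open>Frames composed of finitely many localised bases\<close>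

text \<open>
  The model case is an orthonormal basis of a larger domain, cut off outside \<open>A\<close>: its coefficients
  see exactly the restriction of \<open>f\<close> to \<open>A\<close>. The last condition is a quantitative form of
  \<open>\<Sum>\<^sub>k \<langle>f, e\<^sub>k\<rangle> e\<^sub>k = 1\<^sub>A f\<close>: the error of a finite partial sum is bounded by the coefficient mass
  that it misses. It is an inequality only because cutting off to \<open>A\<close> discards a part of the error.
\<close>

definition local_tight_family ::
  "'a measure \<Rightarrow> real \<Rightarrow> 'a set \<Rightarrow> 'k set \<Rightarrow> ('k \<Rightarrow> 'a \<Rightarrow> complex) \<Rightarrow> bool" where
  "local_tight_family M \<gamma> A K e \<longleftrightarrow> (\<forall>k\<in>K. e k \<in> L2_space M) \<and>
     (\<forall>f\<in>L2_space M.
        ((\<lambda>k. (cmod (L2_inner M \<gamma> f (e k)))\<^sup>2) has_sum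
           (L2_norm M \<gamma> (\<lambda>x. indicator A x * f x))\<^sup>2) K \<and>
        (\<forall>F. finite F \<longrightarrow> F \<subseteq> K \<longrightarrow>
           (L2_norm M \<gamma> (\<lambda>x. (\<Sum>k\<in>F. L2_inner M \<gamma> f (e k) * e k x) - indicator A x * f x))\<^sup>2
           \<le> (L2_norm M \<gamma> (\<lambda>x. indicator A x * f x))\<^sup>2
              - (\<Sum>k\<in>F. (cmod (L2_inner M \<gamma> f (e k)))\<^sup>2)))"

lemma has_sum_disjoint_Union:
  fixes f :: "'k \<Rightarrow> 'b::topological_comm_monoid_add"
  assumes "finite J" and "\<And>g. g \<in> J \<Longrightarrow> (f has_sum a g) (K g)" and "disjoint_family_on K J"
  shows "(f has_sum (\<Sum>g\<in>J. a g)) (\<Union>g\<in>J. K g)"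
  using assms
proof (induction J)
  case (insert g J)
  have "(f has_sum (\<Sum>g\<in>J. a g)) (\<Union>g\<in>J. K g)"
    using insert by (auto simp: disjoint_family_on_def)
  moreover have "K g \<inter> (\<Union>g\<in>J. K g) = {}"
    using insert by (fastforce simp: disjoint_family_on_def)
  ultimately show ?case
    using insert has_sum_Un_disjoint[where f = f and A = "K g" and B = "\<Union>g\<in>J. K g"] by auto
qed simp

text \<open>
  Adding up the local families adds up the indicators. A finite partial sum over the joint index set
  splits into partial sums of the local families, so its squared error is at most \<open>card J\<close> times the
  coefficient mass missed altogether; this tends to 0 because the coefficient sum converges.
\<close>

lemma overlay_coefficients_and_series:
  fixes A :: "'g \<Rightarrow> 'a set"
  assumes \<gamma>: "\<gamma> > 0" and J: "finite J" and A: "\<And>g. g \<in> J \<Longrightarrow> A g \<in> sets M"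
    and loc: "\<And>g. g \<in> J \<Longrightarrow> local_tight_family M \<gamma> (A g) (K g) e"
    and disj: "disjoint_family_on K J" and f: "f \<in> L2_space M"
  shows "((\<lambda>k. (cmod (L2_inner M \<gamma> f (e k)))\<^sup>2) has_sum
            (\<Sum>g\<in>J. (L2_norm M \<gamma> (\<lambda>x. indicator (A g) x * f x))\<^sup>2)) (\<Union>g\<in>J. K g)" (is ?sum)
    and "((\<lambda>F. L2_norm M \<gamma> (\<lambda>x. (\<Sum>k\<in>F. L2_inner M \<gamma> f (e k) * e k x) -
            (\<Sum>g\<in>J. indicator (A g) x) * f x)) \<longlongrightarrow> 0) (finite_subsets_at_top (\<Union>g\<in>J. K g))"
proof -
  let ?K = "\<Union>g\<in>J. K g"
  define a where "a k = L2_inner M \<gamma> f (e k)" for k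
  define N where "N g = (L2_norm M \<gamma> (\<lambda>x. indicator (A g) x * f x))\<^sup>2" for g
  have eL: "e k \<in> L2_space M" if "k \<in> ?K" for k
    using loc that unfolding local_tight_family_def by blast
  have hs: "((\<lambda>k. (cmod (a k))\<^sup>2) has_sum N g) (K g)" if "g \<in> J" for g
    using loc[OF that] f by (simp add: local_tight_family_def a_def N_def)
  show sum: ?sum
    using has_sum_disjoint_Union[OF J hs disj] by (simp add: a_def N_def)
  have bound: "(L2_norm M \<gamma> (\<lambda>x. (\<Sum>k\<in>F. a k * e k x) - (\<Sum>g\<in>J. indicator (A g) x) * f x))\<^sup>2
      \<le> card J * ((\<Sum>g\<in>J. N g) - (\<Sum>k\<in>F. (cmod (a k))\<^sup>2))"
    if F: "finite F" "F \<subseteq> ?K" for F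
  proof -
    have split: "(\<Sum>k\<in>F. w k) = (\<Sum>g\<in>J. \<Sum>k\<in>F \<inter> K g. w k)" for w :: "'b \<Rightarrow> 'c::comm_monoid_add"
    proof -
      have "(\<Sum>k\<in>(\<Union>g\<in>J. F \<inter> K g). w k) = (\<Sum>g\<in>J. \<Sum>k\<in>F \<inter> K g. w k)"
        using J F disj by (intro sum.UNION_disjoint) (fastforce simp: disjoint_family_on_def)+
      moreover have "(\<Union>g\<in>J. F \<inter> K g) = F" using F by auto
      ultimately show ?thesis by simp
    qed
    let ?u = "\<lambda>g x. (\<Sum>k\<in>F \<inter> K g. a k * e k x) - indicator (A g) x * f x"
    have u: "?u g \<in> L2_space M" if "g \<in> J" for g
      using F that
      by (intro L2_space_diff L2_space_sum L2_space_cmult L2_space_indicator_mult f A eL) auto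
    have "(L2_norm M \<gamma> (\<lambda>x. \<Sum>g\<in>J. ?u g x))\<^sup>2 \<le> card J * (\<Sum>g\<in>J. (L2_norm M \<gamma> (?u g))\<^sup>2)"
      by (rule L2_norm_sum_squared_le[OF \<gamma> J u])
    also have "\<dots> \<le> card J * (\<Sum>g\<in>J. N g - (\<Sum>k\<in>F \<inter> K g. (cmod (a k))\<^sup>2))"
    proof (intro mult_left_mono sum_mono)
      fix g assume "g \<in> J"
      show "(L2_norm M \<gamma> (?u g))\<^sup>2 \<le> N g - (\<Sum>k\<in>F \<inter> K g. (cmod (a k))\<^sup>2)"
        using loc[OF \<open>g \<in> J\<close>] f F unfolding local_tight_family_def a_def N_def by blast
    qed simp
    also have "(\<Sum>g\<in>J. N g - (\<Sum>k\<in>F \<inter> K g. (cmod (a k))\<^sup>2)) = (\<Sum>g\<in>J. N g) - (\<Sum>k\<in>F. (cmod (a k))\<^sup>2)"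
      by (simp add: sum_subtractf split[of "\<lambda>k. (cmod (a k))\<^sup>2"])
    also have "(\<lambda>x. \<Sum>g\<in>J. ?u g x) = (\<lambda>x. (\<Sum>k\<in>F. a k * e k x) - (\<Sum>g\<in>J. indicator (A g) x) * f x)"
      by (simp add: fun_eq_iff sum_subtractf sum_distrib_right split[of "\<lambda>k. a k * e k x" for x])
    finally show ?thesis .
  qed
  have "((\<lambda>F. card J * ((\<Sum>g\<in>J. N g) - (\<Sum>k\<in>F. (cmod (a k))\<^sup>2))) \<longlongrightarrow>
      card J * ((\<Sum>g\<in>J. N g) - (\<Sum>g\<in>J. N g))) (finite_subsets_at_top ?K)"
    using has_sum_disjoint_Union[OF J hs disj] unfolding has_sum_def by (intro tendsto_intros)
  then have z: "((\<lambda>F. card J * ((\<Sum>g\<in>J. N g) - (\<Sum>k\<in>F. (cmod (a k))\<^sup>2))) \<longlongrightarrow> 0) (finite_subsets_at_top ?K)"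
    by simp
  have "((\<lambda>F. (L2_norm M \<gamma> (\<lambda>x. (\<Sum>k\<in>F. a k * e k x) - (\<Sum>g\<in>J. indicator (A g) x) * f x))\<^sup>2)
     \<longlongrightarrow> 0) (finite_subsets_at_top ?K)"
    by (rule tendsto_sandwich[OF _ _ tendsto_const z])
       (auto intro!: eventually_finite_subsets_at_top_weakI bound)
  then have "((\<lambda>F. sqrt ((L2_norm M \<gamma> (\<lambda>x. (\<Sum>k\<in>F. a k * e k x) - (\<Sum>g\<in>J. indicator (A g) x) * f x))\<^sup>2))
     \<longlongrightarrow> sqrt 0) (finite_subsets_at_top ?K)"
    by (rule tendsto_real_sqrt)
  then show "((\<lambda>F. L2_norm M \<gamma> (\<lambda>x. (\<Sum>k\<in>F. L2_inner M \<gamma> f (e k) * e k x) -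
            (\<Sum>g\<in>J. indicator (A g) x) * f x)) \<longlongrightarrow> 0) (finite_subsets_at_top ?K)"
    by (simp add: a_def L2_norm_nonneg[OF \<gamma>])
qed

text \<open>
  Whichever representative the definition of the frame operator chooses, it agrees almost everywhere
  with any function to which the frame series converges.
\<close>

lemma frame_operator_AE_eq:
  assumes \<gamma>: "\<gamma> > 0" and e: "\<And>k. k \<in> K \<Longrightarrow> e k \<in> L2_space M" and t: "t \<in> L2_space M"
    and lim: "((\<lambda>F. L2_norm M \<gamma> (\<lambda>x. (\<Sum>k\<in>F. L2_inner M \<gamma> f (e k) * e k x) - t x)) \<longlongrightarrow> 0)
                (finite_subsets_at_top K)"
  shows "AE x in M. frame_operator M \<gamma> K e f x = t x"
proof -
  let ?p = "\<lambda>F x. \<Sum>k\<in>F \<inter> K. L2_inner M \<gamma> f (e k) * e k x"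
  let ?Q = "\<lambda>s. s \<in> L2_space M \<and>
      ((\<lambda>F. L2_norm M \<gamma> (\<lambda>x. (\<Sum>k\<in>F. L2_inner M \<gamma> f (e k) * e k x) - s x)) \<longlongrightarrow> 0)
        (finite_subsets_at_top K)"
  have Q: "?Q (frame_operator M \<gamma> K e f)"
    unfolding frame_operator_def by (rule someI[of ?Q t]) (use t lim in auto)
  have conv: "((\<lambda>F. L2_norm M \<gamma> (\<lambda>x. ?p F x - s x)) \<longlongrightarrow> 0) (finite_subsets_at_top K)"
    if "?Q s" for s
    by (rule Lim_transform_eventually[OF conjunct2[OF that]])
       (auto intro!: eventually_finite_subsets_at_top_weakI simp: Int_absorb2)
  show ?thesis
    by (rule L2_norm_limit_unique[OF \<gamma> finite_subsets_at_top_neq_bot _ _ t conv conv])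
       (use Q t lim e in \<open>auto intro!: L2_space_sum L2_space_cmult\<close>)
qed

text \<open>
  The frame operator is multiplication by \<open>w = \<Sum>\<^sub>g 1\<^bsub>A g\<^esub>\<close>. Since the sets cover the space,
  \<open>1 \<le> w \<le> card J\<close>; these are frame bounds, and they make division by \<open>w\<close> a bounded operation on the
  space, which is therefore the inverse of the frame operator.
\<close>

theorem overlay_dual_frame:
  fixes A :: "'g \<Rightarrow> 'a set"
  assumes \<gamma>: "\<gamma> > 0" and J: "finite J" and A: "\<And>g. g \<in> J \<Longrightarrow> A g \<in> sets M"
    and cover: "space M \<subseteq> (\<Union>g\<in>J. A g)"
    and loc: "\<And>g. g \<in> J \<Longrightarrow> local_tight_family M \<gamma> (A g) (K g) e"
    and disj: "disjoint_family_on K J" and k: "k \<in> (\<Union>g\<in>J. K g)"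
  shows "AE x in M. dual_frame M \<gamma> (\<Union>g\<in>J. K g) e k x = e k x / of_real (\<Sum>g\<in>J. indicator (A g) x)"
proof -
  let ?K = "\<Union>g\<in>J. K g"
  define w :: "'a \<Rightarrow> real" where "w x = (\<Sum>g\<in>J. indicator (A g) x)" for x
  have eL: "e k \<in> L2_space M" if "k \<in> ?K" for k
    using loc that unfolding local_tight_family_def by blast
  have w_meas: "w \<in> borel_measurable M"
    unfolding w_def using A by (intro borel_measurable_sum borel_measurable_indicator)
  have w_ge: "1 \<le> w x" if x: "x \<in> space M" for x
  proof -
    obtain g where g: "g \<in> J" "x \<in> A g" using cover x by blast
    have "indicator (A g) x \<le> w x"
      unfolding w_def using g J by (intro member_le_sum) auto
    then show ?thesis using g by simp
  qed
  have w_le: "w x \<le> card J" for x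
    using sum_bounded_above[of J "\<lambda>g. indicator (A g) x" "1::real"] by (auto simp: w_def indicator_def)
  have J1: "1 \<le> card J" using J k by (auto simp: Suc_le_eq card_gt_0_iff)
  have w_total: "(\<Sum>g\<in>J. (L2_norm M \<gamma> (\<lambda>x. indicator (A g) x * f x))\<^sup>2)
      = 1 / \<gamma> * (LINT x|M. w x * (cmod (f x))\<^sup>2)" 
    and w_int: "integrable M (\<lambda>x. w x * (cmod (f x))\<^sup>2)" if f: "f \<in> L2_space M" for f
  proof -
    have eq: "(cmod (indicator (A g) x * f x))\<^sup>2 = indicator (A g) x * (cmod (f x))\<^sup>2" for g x
      by (auto simp: indicator_def)
    have int: "integrable M (\<lambda>x. indicator (A g) x * (cmod (f x))\<^sup>2)" if "g \<in> J" for g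
      using L2_space_integrable[OF L2_space_indicator_mult[OF f A[OF that]]] by (simp only: eq)
    show "integrable M (\<lambda>x. w x * (cmod (f x))\<^sup>2)"
      unfolding w_def sum_distrib_right by (intro Bochner_Integration.integrable_sum int)
    have "(LINT x|M. w x * (cmod (f x))\<^sup>2) = (\<Sum>g\<in>J. LINT x|M. indicator (A g) x * (cmod (f x))\<^sup>2)"
      unfolding w_def sum_distrib_right by (intro Bochner_Integration.integral_sum int)
    then show "(\<Sum>g\<in>J. (L2_norm M \<gamma> (\<lambda>x. indicator (A g) x * f x))\<^sup>2)
      = 1 / \<gamma> * (LINT x|M. w x * (cmod (f x))\<^sup>2)"
      unfolding L2_norm_squared[OF \<gamma>] eq by (simp add: sum_divide_distrib)
  qed
  have frame: "L2_frame M \<gamma> ?K e"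
    unfolding L2_frame_def
  proof (intro conjI ballI exI)
    show "(0::real) < 1" "1 \<le> real (card J)" using J1 by auto
    fix f assume f: "f \<in> L2_space M"
    have hs: "((\<lambda>k. (cmod (L2_inner M \<gamma> f (e k)))\<^sup>2) has_sum
        1 / \<gamma> * (LINT x|M. w x * (cmod (f x))\<^sup>2)) ?K"
      using overlay_coefficients_and_series(1)[OF \<gamma> J A loc disj f] by (simp only: w_total[OF f])
    show "(\<lambda>k. (cmod (L2_inner M \<gamma> f (e k)))\<^sup>2) summable_on ?K"
      using hs by (auto simp: summable_on_def)
    have "(LINT x|M. (cmod (f x))\<^sup>2) \<le> (LINT x|M. w x * (cmod (f x))\<^sup>2)"
      by (intro integral_mono w_int f L2_space_integrable) (use w_ge mult_right_mono in fastforce)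
    then show "1 * (L2_norm M \<gamma> f)\<^sup>2 \<le> (\<Sum>\<^sub>\<infinity>k\<in>?K. (cmod (L2_inner M \<gamma> f (e k)))\<^sup>2)"
      unfolding infsumI[OF hs] L2_norm_squared[OF \<gamma>] using \<gamma> by (simp add: divide_right_mono)
    have "(LINT x|M. w x * (cmod (f x))\<^sup>2) \<le> (LINT x|M. card J * (cmod (f x))\<^sup>2)"
      by (intro integral_mono w_int f mult_right_mono w_le)
         (use L2_space_integrable[OF f] in auto)
    then show "(\<Sum>\<^sub>\<infinity>k\<in>?K. (cmod (L2_inner M \<gamma> f (e k)))\<^sup>2) \<le> card J * (L2_norm M \<gamma> f)\<^sup>2"
      unfolding infsumI[OF hs] L2_norm_squared[OF \<gamma>] using \<gamma> by (simp add: divide_right_mono)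
  qed (use eL in auto)
  have S: "AE x in M. frame_operator M \<gamma> ?K e f x = of_real (w x) * f x" if f: "f \<in> L2_space M" for f
  proof (rule frame_operator_AE_eq[OF \<gamma>])
    show "(\<lambda>x. of_real (w x) * f x) \<in> L2_space M"
    proof (rule L2_space_mult_bounded[OF f])
      show "cmod (of_real (w x)) \<le> card J" if "x \<in> space M" for x
        using w_ge[OF that] w_le[of x] by simp
    qed (use w_meas in measurable)
    show "((\<lambda>F. L2_norm M \<gamma> (\<lambda>x. (\<Sum>k\<in>F. L2_inner M \<gamma> f (e k) * e k x) - of_real (w x) * f x)) \<longlongrightarrow> 0)
       (finite_subsets_at_top ?K)"
      using overlay_coefficients_and_series(2)[OF \<gamma> J A loc disj f]
      by (simp add: w_def indicator_def of_bool_def if_distrib cong: if_cong)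
  qed (use eL in auto)
  let ?Q = "\<lambda>f. f \<in> L2_space M \<and> (AE x in M. frame_operator M \<gamma> ?K e f x = e k x)"
  let ?d = "\<lambda>x. of_real (1 / w x) * e k x"
  have d: "?d \<in> L2_space M"
  proof (rule L2_space_mult_bounded[OF eL[OF k]])
    show "cmod (of_real (1 / w x)) \<le> 1" if "x \<in> space M" for x
      using w_ge[OF that] by (simp add: norm_divide)
  qed (use w_meas in measurable)
  have "AE x in M. frame_operator M \<gamma> ?K e ?d x = e k x"
    using S[OF d] AE_space
  proof eventually_elim
    case (elim x)
    then show ?case using w_ge[of x] by simp
  qed
  with d have "?Q ?d" by blast
  then have Q: "?Q (inv_frame_operator M \<gamma> ?K e (e k))"
    unfolding inv_frame_operator_def by (rule someI[of ?Q])
  have "AE x in M. inv_frame_operator M \<gamma> ?K e (e k) x = e k x / of_real (w x)"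
    using S[OF conjunct1[OF Q]] conjunct2[OF Q] AE_space
  proof eventually_elim
    case (elim x)
    then have "e k x = of_real (w x) * inv_frame_operator M \<gamma> ?K e (e k) x" by simp
    then show ?case using w_ge[OF elim(3)] by simp
  qed
  then show ?thesis using frame by (simp add: dual_frame_def w_def)
qed

section \<open>The double Fourier system on a square\<close>

lemma square_domain_cbox: "square_domain T = cbox (-T, -T) (T, T)"
  by (auto simp: square_domain_def cbox_Pair_eq)

lemma sets_square_domain: "square_domain T \<in> sets lebesgue"
  by (simp add: square_domain_cbox)

lemma continuous_on_imp_L2_space_square:
  fixes f :: "real \<times> real \<Rightarrow> complex"
  assumes "continuous_on (square_domain T) f"
  shows "f \<in> L2_space (lebesgue_on (square_domain T))"
proof -
  have "f \<in> borel_measurable (lebesgue_on (square_domain T))"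
    by (rule continuous_imp_measurable_on_sets_lebesgue[OF assms sets_square_domain])
  moreover have "integrable (lebesgue_on (square_domain T)) (\<lambda>x. (cmod (f x))\<^sup>2)"
    using assms unfolding square_domain_cbox
    by (intro continuous_imp_integrable continuous_intros)
  ultimately show ?thesis by (simp add: L2_space_def)
qed

lemma continuous_on_fourier_fun: "continuous_on S (fourier_fun T j k)"
  unfolding fourier_fun_def split_def by (intro continuous_intros)

lemma integral_exp_period:
  assumes "T > 0"
  shows "integral {-T..T} (\<lambda>x. exp (\<i> * of_real (pi / T * (of_int n * x)))) = (if n = 0 then 2 * of_real T else 0 :: complex)"
proof (cases "n = 0")
  case True
  then show ?thesis using assms by (simp add: scaleR_conv_of_real)
next
  case False
  define a :: complex where "a = \<i> * of_real (pi / T * of_int n)"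
  have a: "a \<noteq> 0" using False assms by (simp add: a_def)
  have eq: "exp (\<i> * of_real (pi / T * (of_int n * x))) = exp (a * of_real x)" for x
    by (simp add: a_def algebra_simps)
  have "((\<lambda>x. exp (a * of_real x)) has_integral (exp (a * of_real T) / a - exp (a * of_real (-T)) / a)) {-T..T}"
  proof (rule fundamental_theorem_of_calculus)
    fix x
    have "((\<lambda>z. exp (a * z) / a) has_field_derivative exp (a * of_real x)) (at (of_real x))"
      using a by (auto intro!: derivative_eq_intros)
    then show "((\<lambda>x. exp (a * of_real x) / a) has_vector_derivative exp (a * of_real x)) (at x within {-T..T})"
      by (rule has_vector_derivative_at_within[OF has_vector_derivative_real_field])
  qed (use assms in simp)
  moreover have "exp (a * of_real T) = exp (a * of_real (-T))"
  proof -
    have "a * of_real T = a * of_real (-T) + (2 * of_int n * of_real pi) * \<i>"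
      using assms by (simp add: a_def field_simps)
    then show ?thesis unfolding exp_eq by (intro exI[of _ n]) simp
  qed
  ultimately have "integral {-T..T} (\<lambda>x. exp (a * of_real x)) = 0"
    by (simp add: integral_unique)
  then show ?thesis using False by (simp only: eq if_False)
qed

text \<open>
  By Fubini, the inner product factors into two integrals of exponentials over full periods, which
  vanish unless the frequencies agree.
\<close>

lemma orthonormal_fourier:
  assumes "T > 0"
  shows "orthonormal_family (lebesgue_on (square_domain T)) (\<lambda>(j, k). fourier_fun T j k)"
proof -
  let ?M = "lebesgue_on (square_domain T)"
  have "L2_inner ?M 1 (fourier_fun T j k) (fourier_fun T j' k') = of_bool (j = j' \<and> k = k')" for j k j' k'
  proof -
    let ?E = "\<lambda>n x. exp (\<i> * of_real (pi / T * (of_int n * x))) :: complex"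
    let ?f = "\<lambda>r. fourier_fun T j k r * cnj (fourier_fun T j' k' r)"
    have f: "?f (x, y) = of_real (1 / (4 * T\<^sup>2)) * (?E (j - j') x * ?E (k - k') y)" for x y
      by (simp add: fourier_fun_def exp_cnj power2_eq_square algebra_simps add_divide_distrib
          diff_divide_distrib flip: exp_add)
    have cont: "continuous_on (square_domain T) ?f"
      by (intro continuous_intros continuous_on_fourier_fun)
    have "L2_inner ?M 1 (fourier_fun T j k) (fourier_fun T j' k') = integral (square_domain T) ?f"
      using cont unfolding L2_inner_def square_domain_cbox
      by (simp add: lebesgue_integral_eq_integral continuous_imp_integrable)
    also have "\<dots> = integral {-T..T} (\<lambda>x. integral {-T..T} (\<lambda>y. ?f (x, y)))"
      using cont unfolding square_domain_cbox by (simp add: integral_prod_continuous)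
    also have "\<dots> = of_real (1 / (4 * T\<^sup>2)) *
        (integral {-T..T} (?E (j - j')) * integral {-T..T} (?E (k - k')))"
      unfolding f by simp
    also have "\<dots> = of_bool (j = j' \<and> k = k')"
      unfolding integral_exp_period[OF assms] using assms
      by (simp add: power2_eq_square scaleR_conv_of_real)
    finally show ?thesis .
  qed
  then show ?thesis
    by (auto simp: orthonormal_family_def
        intro!: continuous_on_imp_L2_space_square continuous_on_fourier_fun)
qed

section \<open>Density of the trigonometric polynomials\<close>

inductive trig_poly :: "real \<Rightarrow> (real \<times> real \<Rightarrow> complex) \<Rightarrow> bool" for T where
  monomial: "trig_poly T (\<lambda>r. a * fourier_fun T j k r)"
| add: "trig_poly T p \<Longrightarrow> trig_poly T q \<Longrightarrow> trig_poly T (\<lambda>r. p r + q r)"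

lemma trig_poly_const:
  assumes "T > 0"
  shows "trig_poly T (\<lambda>r. a)"
  using trig_poly.monomial[of T "a * of_real (2 * T)" 0 0] assms by (simp add: fourier_fun_def split_def)

lemma trig_poly_term_mult:
  assumes "T > 0" "trig_poly T q"
  shows "trig_poly T (\<lambda>r. a * fourier_fun T j k r * q r)"
  using assms(2)
proof induction
  case (monomial b j' k')
  have "(\<lambda>r. a * fourier_fun T j k r * (b * fourier_fun T j' k' r)) =
      (\<lambda>r. (a * b / of_real (2 * T)) * fourier_fun T (j + j') (k + k') r)"
    by (simp add: fun_eq_iff fourier_fun_def algebra_simps add_divide_distrib exp_add)
  then show ?case by (simp only: trig_poly.monomial)
next
  case (add p q)
  then show ?case using trig_poly.add by (fastforce simp: distrib_left)
qed

lemma trig_poly_mult: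
  assumes "T > 0" "trig_poly T p" "trig_poly T q"
  shows "trig_poly T (\<lambda>r. p r * q r)"
  using assms(2)
proof induction
  case (monomial a j k)
  then show ?case by (rule trig_poly_term_mult[OF assms(1,3)])
next
  case (add p p')
  then show ?case using trig_poly.add by (fastforce simp: distrib_right)
qed

lemma trig_poly_imp_finite_sum:
  assumes "trig_poly T p"
  obtains F d where "finite F" "p = (\<lambda>r. \<Sum>(j, k)\<in>F. d (j, k) * fourier_fun T j k r)"
proof -
  have "\<exists>F d. finite F \<and> (\<forall>i. i \<notin> F \<longrightarrow> d i = 0) \<and> p = (\<lambda>r. \<Sum>(j, k)\<in>F. d (j, k) * fourier_fun T j k r)"
    using assms
  proof induction
    case (monomial a j k)
    show ?case by (intro exI[of _ "{(j, k)}"] exI[of _ "(\<lambda>_. 0)((j, k) := a)"]) auto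
  next
    case (add p q)
    obtain F d where F: "finite F \<and> (\<forall>i. i \<notin> F \<longrightarrow> d i = 0) \<and>
        p = (\<lambda>r. \<Sum>(j, k)\<in>F. d (j, k) * fourier_fun T j k r)"
      using add.IH(1) by (elim exE)
    obtain F' d' where F': "finite F' \<and> (\<forall>i. i \<notin> F' \<longrightarrow> d' i = 0) \<and>
        q = (\<lambda>r. \<Sum>(j, k)\<in>F'. d' (j, k) * fourier_fun T j k r)"
      using add.IH(2) by (elim exE)
    have p: "p r = (\<Sum>(j, k)\<in>F. d (j, k) * fourier_fun T j k r)"
      and q: "q r = (\<Sum>(j, k)\<in>F'. d' (j, k) * fourier_fun T j k r)" for r
      using F F' by simp_all
    have "p r = (\<Sum>(j, k)\<in>F \<union> F'. d (j, k) * fourier_fun T j k r)" for r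
      unfolding p using F F' by (intro sum.mono_neutral_left) auto
    moreover have "q r = (\<Sum>(j, k)\<in>F \<union> F'. d' (j, k) * fourier_fun T j k r)" for r
      unfolding q using F F' by (intro sum.mono_neutral_left) auto
    ultimately show ?case using F F'
      by (intro exI[of _ "F \<union> F'"] exI[of _ "\<lambda>i. d i + d' i"])
        (auto simp: fun_eq_iff distrib_right sum.distrib split_def)
  qed
  then show ?thesis using that by blast
qed

text \<open>
  Wrapping the square around the torus identifies opposite sides. Polynomials on the torus pull back
  to trigonometric polynomials.
\<close>

definition torus_map :: "real \<Rightarrow> real \<times> real \<Rightarrow> complex \<times> complex" where
  "torus_map T r = (cis (pi / T * fst r), cis (pi / T * snd r))"

text \<open>
  A real linear functional depends only on the real and imaginary parts of the two coordinates, that is,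
  on \<open>cos\<close> and \<open>sin\<close> of the two angles; Euler's formulas turn these into the frequencies
  \<open>(\<plusminus>1, 0)\<close> and \<open>(0, \<plusminus>1)\<close>.
\<close>

lemma trig_poly_torus_linear:
  assumes T: "T > 0" and q: "bounded_linear q"
  shows "trig_poly T (\<lambda>r. of_real (q (torus_map T r)))"
proof -
  have expand: "q (z, w) = Re z * q (1, 0) + Im z * q (\<i>, 0) + Re w * q (0, 1) + Im w * q (0, \<i>)" for z w
  proof -
    have "(z, w) = Re z *\<^sub>R (1, 0) + Im z *\<^sub>R (\<i>, 0) + Re w *\<^sub>R (0, 1) + Im w *\<^sub>R (0, \<i>)"
      by (auto simp: complex_eq_iff)
    then have "q (z, w) = q (Re z *\<^sub>R (1, 0) + Im z *\<^sub>R (\<i>, 0) + Re w *\<^sub>R (0, 1) + Im w *\<^sub>R (0, \<i>))"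
      by simp
    then show ?thesis
      by (simp only: bounded_linear.linear[OF q] linear_add linear_scale real_scaleR_def)
  qed
  let ?e = "\<lambda>j k r. of_real (2 * T) * fourier_fun T j k r"
  have e: "?e j k r = cis (pi / T * (of_int j * fst r + of_int k * snd r))" for j k r
    using T by (simp add: fourier_fun_def split_def cis_conv_exp)
  define c where "c = (\<lambda>z w. complex_of_real (q (z, w)))"
  have Re_eq: "complex_of_real (cos t) = (cis t + cis (- t)) / 2"
    and Im_eq: "complex_of_real (sin t) = - (\<i> / 2) * (cis t - cis (- t))" for t
    by (auto simp: complex_eq_iff)
  have "(\<lambda>r. complex_of_real (q (torus_map T r))) = (\<lambda>r.
      (c 1 0 / 2 - \<i> / 2 * c \<i> 0) * of_real (2 * T) * fourier_fun T 1 0 r +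
      (c 1 0 / 2 + \<i> / 2 * c \<i> 0) * of_real (2 * T) * fourier_fun T (-1) 0 r +
      (c 0 1 / 2 - \<i> / 2 * c 0 \<i>) * of_real (2 * T) * fourier_fun T 0 1 r +
      (c 0 1 / 2 + \<i> / 2 * c 0 \<i>) * of_real (2 * T) * fourier_fun T 0 (-1) r)"
  proof
    fix r
    have coeff: "(u + v) / 2 * a + - w * (u - v) * b = (a / 2 - w * b) * u + (a / 2 + w * b) * v"
      for u v a b w :: complex
      by (simp add: field_simps)
    define s t where "s = pi / T * fst r" and "t = pi / T * snd r"
    have e': "?e 1 0 r = cis s" "?e (-1) 0 r = cis (- s)" "?e 0 1 r = cis t" "?e 0 (-1) r = cis (- t)"
      unfolding e by (simp_all add: s_def t_def)
    have "complex_of_real (q (torus_map T r)) = of_real (cos s) * c 1 0 + of_real (sin s) * c \<i> 0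
        + (of_real (cos t) * c 0 1 + of_real (sin t) * c 0 \<i>)"
      using expand[of "cis s" "cis t"] by (simp add: torus_map_def c_def s_def t_def)
    then show "complex_of_real (q (torus_map T r)) =
      (c 1 0 / 2 - \<i> / 2 * c \<i> 0) * of_real (2 * T) * fourier_fun T 1 0 r +
      (c 1 0 / 2 + \<i> / 2 * c \<i> 0) * of_real (2 * T) * fourier_fun T (-1) 0 r +
      (c 0 1 / 2 - \<i> / 2 * c 0 \<i>) * of_real (2 * T) * fourier_fun T 0 1 r +
      (c 0 1 / 2 + \<i> / 2 * c 0 \<i>) * of_real (2 * T) * fourier_fun T 0 (-1) r"
      unfolding mult.assoc[of _ "of_real (2 * T)"] e' Re_eq Im_eq
      by (simp only: coeff add.assoc)
  qed
  then show ?thesis by (simp only:) (intro trig_poly.intros)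
qed

lemma trig_poly_torus_real_polynomial:
  assumes T: "T > 0" and q: "real_polynomial_function q"
  shows "trig_poly T (\<lambda>r. of_real (q (torus_map T r)))"
  using q
proof induction
  case (linear f)
  then show ?case by (rule trig_poly_torus_linear[OF T])
next
  case (const c)
  then show ?case by (rule trig_poly_const[OF T])
next
  case (add f g)
  then show ?case using trig_poly.add by fastforce
next
  case (mult f g)
  then show ?case using trig_poly_mult[OF T] by fastforce
qed

lemma trig_poly_torus_polynomial:
  assumes T: "T > 0" and q: "polynomial_function (q :: complex \<times> complex \<Rightarrow> complex)"
  shows "trig_poly T (\<lambda>r. q (torus_map T r))"
proof -
  have "real_polynomial_function (Re \<circ> q)" "real_polynomial_function (Im \<circ> q)"
    using q by (auto simp: polynomial_function_def bounded_linear_Re bounded_linear_Im)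
  then have "trig_poly T (\<lambda>r. of_real (Re (q (torus_map T r))) + \<i> * of_real (Im (q (torus_map T r))))"
    using trig_poly_torus_real_polynomial[OF T]
    by (intro trig_poly.add trig_poly_mult[OF T] trig_poly_const[OF T]) (fastforce simp: o_def)+
  then show ?thesis by (simp flip: complex_eq)
qed

text \<open>
  A function that vanishes on the boundary of the square takes equal values at points identified by
  the torus map, hence factors as \<open>f = H \<circ> torus_map T\<close>. The factor \<open>H\<close> is continuous because the torus
  map is closed on the compact square, and the Stone--Weierstrass theorem approximates it by polynomials
  on the torus.
\<close>

lemma trig_poly_uniform_approximation:
  fixes f :: "real \<times> real \<Rightarrow> complex"
  assumes T: "T > 0" and cont: "continuous_on (square_domain T) f"
    and zero: "\<And>r. r \<in> square_domain T \<Longrightarrow> r \<notin> {-T<..<T} \<times> {-T<..<T} \<Longrightarrow> f r = 0"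
    and \<epsilon>: "\<epsilon> > 0"
  obtains p where "trig_poly T p" "\<And>r. r \<in> square_domain T \<Longrightarrow> cmod (f r - p r) < \<epsilon>"
proof -
  let ?Q = "square_domain T"
  define S where "S = torus_map T ` ?Q"
  define to_square where "to_square zw = (T / pi * Arg (fst zw), T / pi * Arg (snd zw))" for zw
  define H where "H = f \<circ> to_square"
  have cQ: "compact ?Q" by (simp add: square_domain_cbox)
  have ct: "continuous_on A (torus_map T)" for A
    unfolding torus_map_def cis_conv_exp by (intro continuous_intros)
  have S: "compact S" unfolding S_def by (intro compact_continuous_image ct cQ)
  \<comment> \<open>The principal argument recovers the coordinate, except that the side \<open>x = -T\<close> is sent to \<open>x = T\<close>.\<close>
  have arg: "T / pi * Arg (cis (pi / T * x)) = (if x = -T then T else x)" if "x \<in> {-T..T}" for x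
  proof (cases "x = -T")
    case True
    then have "cis (pi / T * x) = - 1" using T by (simp add: complex_eq_iff)
    moreover have "Arg (- 1) = pi" by (simp add: Arg_eq_pi)
    ultimately show ?thesis using T True by simp
  next
    case False
    have "Arg (cis (pi / T * x)) = pi / T * x"
    proof (rule Arg_unique[of 1])
      have "-T < x" "x \<le> T" using that False by auto
      have "pi * (-T) < pi * x" "pi * x \<le> pi * T"
        using \<open>-T < x\<close> \<open>x \<le> T\<close> by (intro mult_strict_left_mono mult_left_mono; simp)+
      then show "- pi < pi / T * x" "pi / T * x \<le> pi"
        using T by (auto simp: field_simps)
    qed (auto simp: cis_conv_exp)
    then show ?thesis using T False by simp
  qed
  have Hf: "H (torus_map T r) = f r" if r: "r \<in> ?Q" for r
  proof -
    let ?r = "to_square (torus_map T r)"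
    have eq: "?r = (if fst r = -T then T else fst r, if snd r = -T then T else snd r)"
      using r arg[of "fst r"] arg[of "snd r"]
      by (auto simp only: square_domain_def to_square_def torus_map_def mem_Times_iff fst_conv snd_conv)
    show ?thesis
    proof (cases "fst r = -T \<or> snd r = -T")
      case True
      then have "f r = 0" "f ?r = 0"
        using r T by (auto intro!: zero simp: eq square_domain_def)
      then show ?thesis by (simp add: H_def)
    next
      case False
      then show ?thesis by (simp add: H_def eq)
    qed
  qed
  have "continuous_on S H"
    unfolding continuous_on_closed_invariant
  proof (intro allI impI)
    \<comment> \<open>Preimages under \<open>H\<close> of closed sets are torus images of compact sets.\<close>
    fix B :: "complex set" assume B: "closed B"
    have "closed (?Q \<inter> f -` B)"
      by (rule continuous_closed_preimage[OF cont compact_imp_closed[OF cQ] B])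
    then have "compact (?Q \<inter> f -` B)"
      using compact_Int_closed[OF cQ] by (metis Int_left_absorb)
    then have "closed (torus_map T ` (?Q \<inter> f -` B))"
      by (intro compact_imp_closed compact_continuous_image ct)
    moreover have "torus_map T ` (?Q \<inter> f -` B) \<inter> S = H -` B \<inter> S"
      using Hf by (auto simp: S_def)
    ultimately show "\<exists>A. closed A \<and> A \<inter> S = H -` B \<inter> S" by blast
  qed
  then obtain q where q: "polynomial_function q" "\<And>z. z \<in> S \<Longrightarrow> cmod (H z - q z) < \<epsilon>"
    using Stone_Weierstrass_polynomial_function[OF S _ \<epsilon>, of H] by blast
  show ?thesis
  proof (rule that)
    show "trig_poly T (\<lambda>r. q (torus_map T r))"
      by (rule trig_poly_torus_polynomial[OF T q(1)])
    show "cmod (f r - q (torus_map T r)) < \<epsilon>" if "r \<in> ?Q" for r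
      using q(2)[of "torus_map T r"] Hf[OF that] that by (simp add: S_def)
  qed
qed

text \<open>
  A bounded measurable function is almost everywhere a limit of continuous functions. Projecting their
  values to the disc of radius \<open>m\<close> keeps them dominated, and multiplying them by cutoff functions that
  increase to 1 inside the open square makes them vanish outside it; the boundary, where the cutoffs
  spoil the limit, is a null set.
\<close>

lemma continuous_vanishing_approximation:
  fixes f :: "real \<times> real \<Rightarrow> complex"
  assumes f: "f \<in> borel_measurable (lebesgue_on (square_domain T))" 
    and bounded: "\<And>r. r \<in> square_domain T \<Longrightarrow> cmod (f r) \<le> m"
    and m: "m \<ge> 0" and \<epsilon>: "\<epsilon> > 0"
  obtains h where "continuous_on UNIV h" "\<And>r. r \<notin> {-T<..<T} \<times> {-T<..<T} \<Longrightarrow> h r = 0"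
    "(LINT r|lebesgue_on (square_domain T). (cmod (f r - h r))\<^sup>2) < \<epsilon>"
proof -
  let ?Q = "square_domain T" and ?U = "{-T<..<T} \<times> {-T<..<T} :: (real \<times> real) set"
  let ?M = "lebesgue_on ?Q"
  have U: "open ?U" by (intro open_Times) auto
  have "(\<lambda>r. if r \<in> ?Q then f r else 0) measurable_on ?Q"
    by (intro lebesgue_measurable_imp_measurable_on borel_measurable_if_I f sets_square_domain)
  then obtain N g where N: "negligible N" and g: "\<And>n. continuous_on UNIV (g n)"
    and lim: "\<And>r. r \<notin> N \<Longrightarrow> (\<lambda>n. g n r) \<longlonglongrightarrow> (if r \<in> ?Q then f r else 0)"
    unfolding measurable_on_def by (auto cong: if_cong)
  \<comment> \<open>The nearest-point projection is continuous and fixes the values of \<open>f\<close>.\<close>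
  define clamp where "clamp = closest_point (cball (0::complex) m)"
  have clamp_cont: "continuous_on A clamp" for A
    using m by (simp add: clamp_def continuous_on_closest_point)
  have clamp_le: "cmod (clamp z) \<le> m" for z
    using m closest_point_in_set[of "cball (0::complex) m" z] by (simp add: clamp_def)
  have clamp_id: "clamp z = z" if "cmod z \<le> m" for z
    using that by (simp add: clamp_def closest_point_self)
  define cutoff where "cutoff n r = min 1 (real n * infdist r (- ?U))" for n :: nat and r
  have cutoff_cont: "continuous_on A (cutoff n)" for A n
    unfolding cutoff_def by (intro continuous_intros)
  have cutoff_range: "0 \<le> cutoff n r" "cutoff n r \<le> 1" for n r
    by (auto simp: cutoff_def infdist_nonneg)
  have cutoff_zero: "cutoff n r = 0" if "r \<notin> ?U" for n r
    using that by (simp add: cutoff_def)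
  have cutoff_lim: "(\<lambda>n. cutoff n r) \<longlonglongrightarrow> 1" if r: "r \<in> ?U" for r
  proof -
    have "- ?U \<noteq> {}" by (metis ComplI SigmaD2 empty_iff greaterThanLessThan_iff order_less_irrefl)
    then have "infdist r (- ?U) \<noteq> 0"
      using in_closed_iff_infdist_zero[of "- ?U" r] U r by (auto simp: closed_Compl)
    then have pos: "infdist r (- ?U) > 0" using infdist_nonneg[of r "- ?U"] by linarith
    obtain n0 :: nat where n0: "1 / infdist r (- ?U) < n0" using reals_Archimedean2 by blast
    have "cutoff n r = 1" if "n \<ge> n0" for n
    proof -
      have "1 / infdist r (- ?U) \<le> n" using n0 that by linarith
      then have "1 \<le> n * infdist r (- ?U)" using pos by (simp add: field_simps)
      then show ?thesis by (simp add: cutoff_def)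
    qed
    then show ?thesis
      by (intro tendsto_eventually) (auto simp: eventually_sequentially)
  qed
  define h where "h n r = of_real (cutoff n r) * clamp (g n r)" for n r
  have h_cont: "continuous_on A (h n)" for A n
  proof -
    have "continuous_on UNIV (\<lambda>r. clamp (g n r))"
      by (rule continuous_on_compose2[OF clamp_cont[of UNIV] g]) auto
    then have "continuous_on UNIV (h n)"
      unfolding h_def by (intro continuous_intros cutoff_cont)
    then show ?thesis by (rule continuous_on_subset) simp
  qed
  have h_le: "cmod (h n r) \<le> m" for n r
    using mult_mono[of "cutoff n r" 1 "cmod (clamp (g n r))" m] cutoff_range m clamp_le
    by (simp add: h_def norm_mult)
  have "(\<lambda>n. LINT r|?M. (cmod (f r - h n r))\<^sup>2) \<longlonglongrightarrow> (LINT r|?M. 0)"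
  proof (rule integral_dominated_convergence[where w = "\<lambda>_. (2 * m)\<^sup>2"])
    have hm: "h n \<in> borel_measurable ?M" for n
      by (rule continuous_imp_measurable_on_sets_lebesgue[OF h_cont sets_square_domain])
    then show "(\<lambda>r. (cmod (f r - h n r))\<^sup>2) \<in> borel_measurable ?M" for n
      using f by measurable
    show "integrable ?M (\<lambda>_. (2 * m)\<^sup>2)"
      by (simp add: square_domain_cbox continuous_imp_integrable)
    show "AE r in ?M. norm ((cmod (f r - h n r))\<^sup>2) \<le> (2 * m)\<^sup>2" for n
    proof (rule AE_I2)
      fix r assume "r \<in> space ?M"
      then have "cmod (f r - h n r) \<le> 2 * m"
        using norm_triangle_ineq4[of "f r" "h n r"] bounded[of r] h_le[of n r] by auto
      then have "(cmod (f r - h n r))\<^sup>2 \<le> (2 * m)\<^sup>2"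
        by (intro power_mono) auto
      then show "norm ((cmod (f r - h n r))\<^sup>2) \<le> (2 * m)\<^sup>2" by simp
    qed
    have "negligible (N \<union> (?Q - ?U))"
    proof -
      have "?U = box (-T, -T) (T, T)" by (auto simp: mem_box Basis_prod_def)
      then have "?Q - ?U = frontier ?Q"
        unfolding square_domain_cbox by (simp add: frontier_def)
      then show ?thesis
        using N by (simp add: square_domain_cbox negligible_convex_frontier)
    qed
    then have "AE r in lebesgue. r \<notin> N \<union> (?Q - ?U)"
      by (intro AE_not_in) (simp only: negligible_iff_null_sets)
    then have "AE r in ?M. r \<notin> N \<union> (?Q - ?U)"
      using sets_square_domain by (subst AE_restrict_space_iff) auto
    then show "AE r in ?M. (\<lambda>n. (cmod (f r - h n r))\<^sup>2) \<longlonglongrightarrow> 0"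
      using AE_space
    proof eventually_elim
      case (elim r)
      then have r: "r \<notin> N" "r \<in> ?U" "r \<in> ?Q" by auto
      have gl: "(\<lambda>n. g n r) \<longlonglongrightarrow> f r" using lim[OF r(1)] r by simp
      have "isCont clamp (f r)"
        using clamp_cont[of UNIV] by (simp add: continuous_on_eq_continuous_at)
      then have "(\<lambda>n. clamp (g n r)) \<longlonglongrightarrow> clamp (f r)"
        using gl isCont_tendsto_compose by blast
      then have "(\<lambda>n. h n r) \<longlonglongrightarrow> of_real 1 * clamp (f r)"
        unfolding h_def by (intro tendsto_intros cutoff_lim r)
      then have "(\<lambda>n. (cmod (f r - h n r))\<^sup>2) \<longlonglongrightarrow> (cmod (f r - of_real 1 * clamp (f r)))\<^sup>2"
        by (intro tendsto_intros)
      then show ?case using clamp_id[OF bounded[OF r(3)]] by simp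
    qed
  qed auto
  then have "(\<lambda>n. LINT r|?M. (cmod (f r - h n r))\<^sup>2) \<longlonglongrightarrow> 0" by simp
  then have "\<forall>\<^sub>F n in sequentially. (LINT r|?M. (cmod (f r - h n r))\<^sup>2) < \<epsilon>"
    using \<epsilon> by (rule order_tendstoD)
  then obtain n where "(LINT r|?M. (cmod (f r - h n r))\<^sup>2) < \<epsilon>"
    using eventually_happens by fastforce
  with h_cont[of UNIV n] cutoff_zero show ?thesis by (intro that[of "h n"]) (auto simp: h_def)
qed

lemma L2_truncation:
  assumes f: "f \<in> L2_space M" and \<epsilon>: "\<epsilon> > 0"
  obtains m :: nat where "(LINT x|M. (cmod (f x - (if cmod (f x) \<le> m then f x else 0)))\<^sup>2) < \<epsilon>"
proof -
  let ?t = "\<lambda>(m::nat) x. if cmod (f x) \<le> m then f x else 0"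
  have fm[measurable]: "f \<in> borel_measurable M" by (rule L2_space_measurable[OF f])
  have "(\<lambda>m. LINT x|M. (cmod (f x - ?t m x))\<^sup>2) \<longlonglongrightarrow> (LINT x|M. 0)"
  proof (rule integral_dominated_convergence[where w = "\<lambda>x. (cmod (f x))\<^sup>2"])
    show "AE x in M. (\<lambda>m. (cmod (f x - ?t m x))\<^sup>2) \<longlonglongrightarrow> 0"
    proof (rule AE_I2)
      fix x
      obtain m0 :: nat where m0: "cmod (f x) \<le> m0" using real_arch_simple by blast
      have "(cmod (f x - ?t m x))\<^sup>2 = 0" if "m \<ge> m0" for m
      proof -
        have "cmod (f x) \<le> m" using m0 that by linarith
        then show ?thesis by simp
      qed
      then show "(\<lambda>m. (cmod (f x - ?t m x))\<^sup>2) \<longlonglongrightarrow> 0"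
        by (intro tendsto_eventually) (unfold eventually_sequentially, blast)
    qed
  qed (use L2_space_integrable[OF f] in auto)
  then have "(\<lambda>m. LINT x|M. (cmod (f x - ?t m x))\<^sup>2) \<longlonglongrightarrow> 0" by simp
  then have "\<forall>\<^sub>F m in sequentially. (LINT x|M. (cmod (f x - ?t m x))\<^sup>2) < \<epsilon>"
    using \<epsilon> by (rule order_tendstoD)
  then show ?thesis using that eventually_happens by fastforce
qed

text \<open>
  Completeness: truncate the function, replace it by a continuous one vanishing on the boundary, and
  approximate the latter uniformly by a trigonometric polynomial.
\<close>

theorem fourier_orthonormal_basis:
  assumes T: "T > 0"
  shows "orthonormal_basis (lebesgue_on (square_domain T)) (\<lambda>(j, k). fourier_fun T j k)"
  unfolding orthonormal_basis_def
proof (intro conjI ballI allI impI)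
  let ?Q = "square_domain T"
  let ?M = "lebesgue_on ?Q"
  show "orthonormal_family ?M (\<lambda>(j, k). fourier_fun T j k)" by (rule orthonormal_fourier[OF T])
  fix f and \<epsilon> :: real assume f: "f \<in> L2_space ?M" and \<epsilon>: "\<epsilon> > 0"
  \<comment> \<open>The errors \<open>\<epsilon> / 16\<close> of truncation and of continuous approximation combine to \<open>\<epsilon> / 4\<close>, and that with \<open>\<epsilon> / 8\<close> from the trigonometric polynomial to \<open>3 \<epsilon> / 4\<close>.\<close>
  obtain m :: nat where m: "(LINT x|?M. (cmod (f x - (if cmod (f x) \<le> m then f x else 0)))\<^sup>2) < \<epsilon> / 16"
    using L2_truncation[OF f, of "\<epsilon> / 16"] \<epsilon> by auto
  define t where "t x = (if cmod (f x) \<le> m then f x else 0)" for x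
  have fm[measurable]: "f \<in> borel_measurable ?M" by (rule L2_space_measurable[OF f])
  have tm: "t \<in> borel_measurable ?M" unfolding t_def by measurable
  have t: "t \<in> L2_space ?M"
    by (rule L2_space_dominated[OF tm L2_space_integrable[OF f]]) (auto simp: t_def)
  obtain h where h: "continuous_on UNIV h" "\<And>r. r \<notin> {-T<..<T} \<times> {-T<..<T} \<Longrightarrow> h r = 0"
      and th: "(LINT r|?M. (cmod (t r - h r))\<^sup>2) < \<epsilon> / 16"
  proof (rule continuous_vanishing_approximation[OF tm, of m "\<epsilon> / 16"])
    show "cmod (t r) \<le> m" for r by (simp add: t_def)
  qed (use \<epsilon> in auto)
  have hQ: "continuous_on ?Q h" using h(1) by (rule continuous_on_subset) simp
  \<comment> \<open>The square has area \<open>4 T\<^sup>2\<close>, so a uniform error \<open>\<delta>\<close> costs at most \<open>4 T\<^sup>2 \<delta>\<^sup>2 = \<epsilon> / 8\<close>.\<close>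
  define \<delta> where "\<delta> = sqrt (\<epsilon> / (32 * T\<^sup>2))"
  have \<delta>: "\<delta> > 0" using \<epsilon> T by (simp add: \<delta>_def)
  obtain p where p: "trig_poly T p" "\<And>r. r \<in> ?Q \<Longrightarrow> cmod (h r - p r) < \<delta>"
    using trig_poly_uniform_approximation[OF T hQ _ \<delta>] h(2) by blast
  obtain F d where F: "finite F" "p = (\<lambda>r. \<Sum>(j, k)\<in>F. d (j, k) * fourier_fun T j k r)"
    using trig_poly_imp_finite_sum[OF p(1)] by blast
  have pc: "continuous_on ?Q p"
    unfolding F(2) split_def by (intro continuous_intros continuous_on_fourier_fun)
  note hL = continuous_on_imp_L2_space_square[OF hQ] and pL = continuous_on_imp_L2_space_square[OF pc]
  have const: "integrable ?M (\<lambda>_. \<delta>\<^sup>2)"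
    by (simp add: square_domain_cbox continuous_imp_integrable)
  have "(LINT r|?M. (cmod (h r - p r))\<^sup>2) \<le> (LINT r|?M. \<delta>\<^sup>2)"
  proof (rule integral_mono[OF L2_space_integrable[OF L2_space_diff[OF hL pL]] const])
    fix r assume "r \<in> space ?M"
    then show "(cmod (h r - p r))\<^sup>2 \<le> \<delta>\<^sup>2"
      using p(2)[of r] by (intro power_mono) auto
  qed
  also have "\<dots> = integral ?Q (\<lambda>_. \<delta>\<^sup>2)"
    by (rule lebesgue_integral_eq_integral[OF const sets_square_domain])
  also have "\<dots> = \<epsilon> / 8"
    using T \<epsilon> by (simp add: square_domain_cbox content_Pair \<delta>_def power2_eq_square)
  finally have hp: "(LINT r|?M. (cmod (h r - p r))\<^sup>2) \<le> \<epsilon> / 8" .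
  have "(LINT r|?M. (cmod (f r - h r))\<^sup>2) < \<epsilon> / 4"
    using LINT_square_diff_le[OF f t hL] m th by (simp add: t_def)
  then have "(LINT r|?M. (cmod (f r - p r))\<^sup>2) < \<epsilon>"
    using LINT_square_diff_le[OF f hL pL] hp \<epsilon> by simp
  then show "\<exists>F d. finite F \<and> (LINT x|?M. (cmod (f x - (\<Sum>k\<in>F. d k * (case k of (j, k) \<Rightarrow> fourier_fun T j k) x)))\<^sup>2) < \<epsilon>"
    using F by (intro exI[of _ F] exI[of _ d]) (simp add: split_def)
qed

section \<open>The layer frame and its dual\<close>

lemma LINT_lebesgue_on_supported:
  fixes u :: "'a::euclidean_space \<Rightarrow> 'b::euclidean_space"
  assumes "S \<in> sets lebesgue" "\<And>r. r \<notin> S \<Longrightarrow> u r = 0"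
  shows "(LINT r|lebesgue_on S. u r) = (LINT r|lebesgue. u r)"
proof -
  have "(\<lambda>r. if r \<in> S then u r else 0) = u" using assms(2) by auto
  then show ?thesis using Lebesgue_Measure.integral_restrict_UNIV[OF assms(1), of u] by simp
qed

lemma L2_space_lebesgue_on_supported:
  fixes u :: "'a::euclidean_space \<Rightarrow> complex"
  assumes "S \<in> sets lebesgue" "\<And>r. r \<notin> S \<Longrightarrow> u r = 0"
  shows "u \<in> L2_space (lebesgue_on S) \<longleftrightarrow> u \<in> L2_space lebesgue"
proof -
  have "(\<lambda>r. if r \<in> S then u r else 0) = u"
    "(\<lambda>r. if r \<in> S then (cmod (u r))\<^sup>2 else 0) = (\<lambda>r. (cmod (u r))\<^sup>2)"
    using assms(2) by auto
  then show ?thesis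
    using borel_measurable_if[OF assms(1), of u]
      Lebesgue_Measure.integrable_restrict_UNIV[OF assms(1), of "\<lambda>r. (cmod (u r))\<^sup>2"]
    by (simp add: L2_space_def)
qed

text \<open>
  For \<open>f\<close> on \<open>\<Omega>\<close>, the function \<open>v = 1\<^sub>A f\<close> lives on \<open>Q\<close> as well, and the inner product of \<open>f\<close> with
  a cut-off basis function is, up to a constant, that of \<open>v\<close> with the basis function on \<open>Q\<close>. Parseval's identity and the
  approximation error for \<open>v\<close> then carry over. The factor \<open>sqrt \<gamma>\<close> in the family is the one that
  compensates the weight \<open>1 / \<gamma>\<close> of the inner product in \<open>\<langle>f, e\<rangle> e\<close>.
\<close>

lemma local_tight_family_restricted_basis:
  fixes \<phi> :: "'k \<Rightarrow> 'a::euclidean_space \<Rightarrow> complex" and i :: "'k \<Rightarrow> 'i"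
  assumes \<gamma>: "\<gamma> > 0"
    and \<Omega>: "\<Omega> \<in> sets lebesgue" and Q: "Q \<in> sets lebesgue" and A: "A \<in> sets lebesgue"
    and A\<Omega>: "A \<subseteq> \<Omega>" and AQ: "A \<subseteq> Q"
    and basis: "orthonormal_basis (lebesgue_on Q) \<phi>"
    and i: "inj i"
    and e: "\<And>k r. e (i k) r = of_real (sqrt \<gamma>) * \<phi> k r * indicator A r"
  shows "local_tight_family (lebesgue_on \<Omega>) \<gamma> A (range i) e"
proof -
  let ?M = "lebesgue_on \<Omega>" and ?N = "lebesgue_on Q"
  have on: "orthonormal_family ?N \<phi>" using basis by (simp add: orthonormal_basis_def)
  have AM: "A \<in> sets ?M" and AN: "A \<in> sets ?N"
    using A A\<Omega> AQ \<Omega> Q by (auto simp: sets_restrict_space_iff)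
  have transfer: "(LINT r|?M. u r) = (LINT r|?N. u r)"
    if "\<And>r. r \<notin> A \<Longrightarrow> u r = 0" for u :: "'a \<Rightarrow> 'b::euclidean_space"
    using LINT_lebesgue_on_supported[OF \<Omega>, of u] LINT_lebesgue_on_supported[OF Q, of u] that A\<Omega> AQ
    by (metis subsetD)
  have transferL2: "u \<in> L2_space ?M \<longleftrightarrow> u \<in> L2_space ?N"
    if "\<And>r. r \<notin> A \<Longrightarrow> u r = 0" for u :: "'a \<Rightarrow> complex"
    using L2_space_lebesgue_on_supported[OF \<Omega>, of u] L2_space_lebesgue_on_supported[OF Q, of u] that A\<Omega> AQ
    by (metis subsetD)
  have eL: "e (i k) \<in> L2_space ?M" for k
  proof -
    have "(\<lambda>r. indicator A r * (of_real (sqrt \<gamma>) * \<phi> k r)) \<in> L2_space ?N"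
      using on by (intro L2_space_indicator_mult AN L2_space_cmult) (simp add: orthonormal_family_def)
    moreover have "(\<lambda>r. indicator A r * (of_real (sqrt \<gamma>) * \<phi> k r)) = e (i k)"
      by (simp add: fun_eq_iff e mult_ac)
    ultimately show ?thesis by (subst transferL2) (auto simp: e)
  qed
  show ?thesis
    unfolding local_tight_family_def
  proof (intro conjI ballI allI impI)
    show "e k \<in> L2_space ?M" if "k \<in> range i" for k using that eL by auto
    fix f assume f: "f \<in> L2_space ?M"
    define v where "v r = indicator A r * f r" for r
    have v0: "v r = 0" if "r \<notin> A" for r using that by (simp add: v_def)
    have vN: "v \<in> L2_space ?N"
      using L2_space_indicator_mult[OF f AM] transferL2[of v] v0 by (simp add: v_def [abs_def])
    define c where "c k = L2_inner ?N 1 v (\<phi> k)" for k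
    have inner: "L2_inner ?M \<gamma> f (e (i k)) = of_real (sqrt \<gamma> / \<gamma>) * c k" for k
    proof -
      have "(LINT r|?M. f r * cnj (e (i k) r)) = (LINT r|?M. of_real (sqrt \<gamma>) * (v r * cnj (\<phi> k r)))"
        by (rule Bochner_Integration.integral_cong) (auto simp: e v_def indicator_def)
      also have "\<dots> = (LINT r|?N. of_real (sqrt \<gamma>) * (v r * cnj (\<phi> k r)))"
        by (rule transfer) (simp add: v0)
      finally show ?thesis by (simp add: L2_inner_def c_def)
    qed
    have inner_sq: "(cmod (L2_inner ?M \<gamma> f (e (i k))))\<^sup>2 = 1 / \<gamma> * (cmod (c k))\<^sup>2" for k
    proof -
      have "(sqrt \<gamma> / \<gamma>)\<^sup>2 = 1 / \<gamma>" using \<gamma> by (simp add: power_divide power2_eq_square)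
      then show ?thesis by (simp only: inner norm_mult power_mult_distrib norm_of_real power2_abs)
    qed
    have norm: "(L2_norm ?M \<gamma> (\<lambda>r. indicator A r * f r))\<^sup>2 = 1 / \<gamma> * (LINT r|?N. (cmod (v r))\<^sup>2)"
      using transfer[of "\<lambda>r. (cmod (v r))\<^sup>2"] v0 by (simp add: L2_norm_squared[OF \<gamma>] v_def)
    have "((\<lambda>k. 1 / \<gamma> * (cmod (c k))\<^sup>2) has_sum 1 / \<gamma> * (LINT r|?N. (cmod (v r))\<^sup>2)) UNIV"
      unfolding c_def by (intro has_sum_cmult_right orthonormal_basis_Parseval basis vN)
    then show "((\<lambda>k. (cmod (L2_inner ?M \<gamma> f (e k)))\<^sup>2) has_sum
        (L2_norm ?M \<gamma> (\<lambda>r. indicator A r * f r))\<^sup>2) (range i)"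
      by (simp add: has_sum_reindex[OF i] o_def inner_sq norm)
    fix F assume F: "finite F" "F \<subseteq> range i"
    obtain F' where F': "F = i ` F'" using F(2) by (meson subset_imageE)
    have inj: "inj_on i F'" using i by (rule inj_on_subset) simp
    have fin: "finite F'" using F(1) unfolding F' by (rule finite_imageD[OF _ inj])
    define p where "p r = (\<Sum>k\<in>F'. c k * \<phi> k r)" for r
    have pN: "p \<in> L2_space ?N"
      unfolding p_def using on
      by (intro L2_space_sum L2_space_cmult) (simp add: orthonormal_family_def)
    have "(\<Sum>k\<in>F. L2_inner ?M \<gamma> f (e k) * e k r) - indicator A r * f r = indicator A r * (v r - p r) * (- 1)" for r
    proof -
      have "(\<Sum>k\<in>F. L2_inner ?M \<gamma> f (e k) * e k r) = (\<Sum>k\<in>F'. c k * \<phi> k r * indicator A r)"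
        unfolding F' sum.reindex[OF inj] o_def
      proof (rule sum.cong)
        fix k
        have "of_real (sqrt \<gamma> / \<gamma>) * complex_of_real (sqrt \<gamma>) = 1"
          using \<gamma> by (simp flip: of_real_mult)
        then show "L2_inner ?M \<gamma> f (e (i k)) * e (i k) r = c k * \<phi> k r * indicator A r"
          unfolding inner e by (metis (no_types, opaque_lifting) mult.assoc mult.commute mult_1)
      qed simp
      then show ?thesis by (simp add: p_def v_def sum_distrib_right[symmetric] indicator_def)
    qed
    then have "(L2_norm ?M \<gamma> (\<lambda>r. (\<Sum>k\<in>F. L2_inner ?M \<gamma> f (e k) * e k r) - indicator A r * f r))\<^sup>2 =
        1 / \<gamma> * (LINT r|?M. (cmod (indicator A r * (v r - p r)))\<^sup>2)"
      by (simp add: L2_norm_squared[OF \<gamma>])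
    also have "(LINT r|?M. (cmod (indicator A r * (v r - p r)))\<^sup>2) = (LINT r|?N. (cmod (indicator A r * (v r - p r)))\<^sup>2)"
      by (rule transfer) simp
    also have "1 / \<gamma> * \<dots> \<le> 1 / \<gamma> * (LINT r|?N. (cmod (v r - p r))\<^sup>2)"
      using \<gamma>
      by (intro mult_left_mono integral_mono L2_space_integrable L2_space_indicator_mult
          L2_space_diff vN pN AN) (auto simp: indicator_def)
    also have "(LINT r|?N. (cmod (v r - p r))\<^sup>2) = (LINT r|?N. (cmod (v r))\<^sup>2) - (\<Sum>k\<in>F'. (cmod (c k))\<^sup>2)"
      using orthonormal_approximation_error[OF on vN fin, of c] by (simp add: p_def c_def)
    also have "1 / \<gamma> * \<dots> = (L2_norm ?M \<gamma> (\<lambda>r. indicator A r * f r))\<^sup>2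
        - (\<Sum>k\<in>F. (cmod (L2_inner ?M \<gamma> f (e k)))\<^sup>2)"
      unfolding F' sum.reindex[OF inj] o_def inner_sq norm
      by (simp add: right_diff_distrib sum_distrib_left diff_divide_distrib sum_divide_distrib)
    finally show "(L2_norm ?M \<gamma> (\<lambda>r. (\<Sum>k\<in>F. L2_inner ?M \<gamma> f (e k) * e k r) - indicator A r * f r))\<^sup>2
        \<le> (L2_norm ?M \<gamma> (\<lambda>r. indicator A r * f r))\<^sup>2 - (\<Sum>k\<in>F. (cmod (L2_inner ?M \<gamma> f (e k)))\<^sup>2)" .
  qed
qed

text \<open>
  Rescaling the argument by \<open>c l g\<close> turns the Fourier function of the square of half-width \<open>T\<close> into
  that of half-width \<open>c l g * T\<close>, and the factor \<open>1 / c l g\<close> is the change of its normalisation.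
\<close>

lemma layer_frame_fun_fourier:
  assumes "c l g > 0"
  shows "layer_frame_fun \<Omega>\<^sub>A \<alpha> h c \<gamma> T l (j, k, g) r =
    of_real (sqrt (\<gamma> l)) * fourier_fun (c l g * T) j k r * indicator (layer_aperture \<Omega>\<^sub>A \<alpha> h c l g) r"
  using assms
  by (cases r) (simp add: layer_frame_fun_def fourier_fun_def field_simps)

lemma open_layer_aperture:
  assumes "open \<Omega>\<^sub>A"
  shows "open (layer_aperture \<Omega>\<^sub>A \<alpha> h c l g)"
proof -
  have "open ((\<lambda>r. (r - h l *\<^sub>R \<alpha> g) /\<^sub>R c l g) -` \<Omega>\<^sub>A)"
    using assms by (intro open_vimage continuous_intros)
  then show ?thesis by (simp add: layer_aperture_def vimage_def)
qed

lemma cone_factor_pos: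
  assumes "0 \<le> h l" "h l < h_LGS"
  shows "cone_factor G_NGS h_LGS h l g > 0"
  using assms by (auto simp: cone_factor_def field_simps)

lemma scaled_square_domain:
  assumes "c > 0"
  shows "(\<lambda>r. c *\<^sub>R r) ` square_domain T \<subseteq> square_domain (c * T)"
  using assms mult_left_mono[of "- T" _ c]
  by (auto simp: square_domain_def)

theorem corollary4p4:
  fixes \<Omega>\<^sub>A :: "(real \<times> real) set"
    and L G G_NGS G_LGS l :: nat
    and h \<gamma> :: "nat \<Rightarrow> real"
    and \<alpha> :: "nat \<Rightarrow> real \<times> real"
    and h_LGS T :: real
    and c :: "nat \<Rightarrow> nat \<Rightarrow> real"
  assumes "open \<Omega>\<^sub>A" and "connected \<Omega>\<^sub>A" and "\<Omega>\<^sub>A \<noteq> {}"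
    and "0 \<le> h 1" and "strict_mono_on {1..L} h"
    and "\<forall>l\<in>{1..L}. \<gamma> l > 0" and "(\<Sum>l=1..L. \<gamma> l) = 1"
    and "G = G_NGS + G_LGS"
    and "\<forall>l\<in>{1..L}. h l < h_LGS"
    and "c = cone_factor G_NGS h_LGS h"
    and "T > 0"
    and "\<forall>l\<in>{1..L}. \<forall>g\<in>{1..G}.
           (\<lambda>r. r + h l *\<^sub>R \<alpha> g) ` \<Omega>\<^sub>A \<subseteq> (\<lambda>r. min_cone_factor c G l *\<^sub>R r) ` square_domain T"
    and "\<Omega>\<^sub>A \<subseteq> square_domain T"
    and "\<forall>l\<in>{1..L}. \<forall>g\<in>{1..G}.
           layer_aperture \<Omega>\<^sub>A \<alpha> h c l g \<subseteq> (\<lambda>r. c l g *\<^sub>R r) ` square_domain T"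
    and "l \<in> {1..L}"
  shows "\<forall>j k :: int. \<forall>g\<in>{1..G}.
           AE r in lebesgue_on (layer_domain \<Omega>\<^sub>A \<alpha> h c G l).
             dual_frame (lebesgue_on (layer_domain \<Omega>\<^sub>A \<alpha> h c G l)) (\<gamma> l)
                 (UNIV \<times> UNIV \<times> {1..G}) (layer_frame_fun \<Omega>\<^sub>A \<alpha> h c \<gamma> T l) (j, k, g) r
             = layer_frame_fun \<Omega>\<^sub>A \<alpha> h c \<gamma> T l (j, k, g) r
               / complex_of_real (overlay \<Omega>\<^sub>A \<alpha> h c G l r)"
proof (intro allI ballI)
  fix j k :: int and g assume g: "g \<in> {1..G}"
  let ?A = "layer_aperture \<Omega>\<^sub>A \<alpha> h c l" and ?\<Omega> = "layer_domain \<Omega>\<^sub>A \<alpha> h c G l"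
    and ?e = "layer_frame_fun \<Omega>\<^sub>A \<alpha> h c \<gamma> T l"
  \<comment> \<open>The ranges of the maps \<open>i g\<close> split the frame into one Fourier family for each guide star.\<close>
  define i :: "nat \<Rightarrow> int \<times> int \<Rightarrow> int \<times> int \<times> nat" where "i g = (\<lambda>(j, k). (j, k, g))" for g
  have "0 \<le> h l"
    using strict_mono_onD[OF assms(5), of 1 l] assms(4,15) by (cases "l = 1") simp_all
  then have c: "c l g > 0" for g
    unfolding assms(10) using assms(9,15) by (intro cone_factor_pos) auto
  have A: "?A g \<in> sets lebesgue" for g
    by (rule sets_completionI_sets) (simp add: open_layer_aperture[OF assms(1)])
  have \<Omega>: "?\<Omega> \<in> sets lebesgue"
    unfolding layer_domain_def using A by auto
  have A\<Omega>: "?A g \<subseteq> ?\<Omega>" if "g \<in> {1..G}" for g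
    using that by (auto simp: layer_domain_def)
  have K: "UNIV \<times> UNIV \<times> {1..G} = (\<Union>g\<in>{1..G}. range (i g))"
    by (auto simp: i_def image_iff)
  have "AE r in lebesgue_on ?\<Omega>. dual_frame (lebesgue_on ?\<Omega>) (\<gamma> l) (\<Union>g\<in>{1..G}. range (i g)) ?e (j, k, g) r
      = ?e (j, k, g) r / of_real (\<Sum>g\<in>{1..G}. indicator (?A g) r)"
  proof (rule overlay_dual_frame)
    show "\<gamma> l > 0" using assms(6,15) by blast
    show "?A g \<in> sets (lebesgue_on ?\<Omega>)" if "g \<in> {1..G}" for g
      using A A\<Omega>[OF that] \<Omega> by (auto simp: sets_restrict_space_iff)
    show "space (lebesgue_on ?\<Omega>) \<subseteq> (\<Union>g\<in>{1..G}. ?A g)"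
      by (auto simp: layer_domain_def)
    show "disjoint_family_on (\<lambda>g. range (i g)) {1..G}"
      by (auto simp: disjoint_family_on_def i_def)
    show "(j, k, g) \<in> (\<Union>g\<in>{1..G}. range (i g))"
      using g unfolding K[symmetric] by simp
    show "local_tight_family (lebesgue_on ?\<Omega>) (\<gamma> l) (?A g) (range (i g)) ?e" if g: "g \<in> {1..G}" for g
    proof (rule local_tight_family_restricted_basis)
      show "orthonormal_basis (lebesgue_on (square_domain (c l g * T))) (\<lambda>(j, k). fourier_fun (c l g * T) j k)"
        using c assms(11) by (intro fourier_orthonormal_basis) simp
      show "?A g \<subseteq> square_domain (c l g * T)"
        using assms(14,15) g scaled_square_domain[OF c, of g T] by blast
      show "inj (i g)" by (auto simp: inj_def i_def)
      show "?e (i g p) r = of_real (sqrt (\<gamma> l)) *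
          (case p of (j, k) \<Rightarrow> fourier_fun (c l g * T) j k) r * indicator (?A g) r" for p r
        by (cases p) (simp add: i_def layer_frame_fun_fourier[of c l g, OF c])
    qed (use A \<Omega> A\<Omega>[OF g] sets_square_domain \<open>\<gamma> l > 0\<close> in auto)
  qed auto
  then show "AE r in lebesgue_on ?\<Omega>. dual_frame (lebesgue_on ?\<Omega>) (\<gamma> l) (UNIV \<times> UNIV \<times> {1..G}) ?e (j, k, g) r
      = ?e (j, k, g) r / of_real (overlay \<Omega>\<^sub>A \<alpha> h c G l r)"
    unfolding K overlay_def .
qed

end
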